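(* Let $A,B\subset\mathrm{SU}(2)$ be non-trivial ADE groups, let $\varphi$ be an automorphism of $A$ with graph $\Gamma(\varphi,A)=\{(x,\varphi(x)):x\in A\}$, and suppose that the (type I) group $\Gamma(\varphi,A)\times B\subset G=\mathrm{SU}(2)^3$ acts freely on $M$ and is not a subgroup of a freely acting splittable group. Then, up to conjugation in $G$, it is one of the following groups. (1) $\Gamma(\varphi,2I)\times\mathbb{Z}_n$ with $3\nmid n$. (2) $\Gamma(\tau_{a,b},2D_{2n})\times\mathbb{Z}_m$ with $n>2$, $a\not\equiv\pm1\bmod 2n$, $4\nmid m$, and, with $\tilde k_1=\gcd(1+a,2n)$ and $\tilde k_2=\gcd(1-a,2n)$, $\gcd(\tilde k_i,m)=1$ for each $i\in\{1,2\}$ with $\tilde k_i>1$. (3) $\Gamma(\varphi(r),\mathbb{Z}_n)\times B$ with $r\not\equiv\pm1\bmod n$, where, with $k_1=\gcd(1+r,n)$ and $k_2=\gcd(1-r,n)$, one of the following holds: - $k_1=k_2=1$ and $B$ is arbitrary; - at least one of $k_1,k_2$ is $>1$, and for every $i\in\{1,2\}$ with $k_i>1$: $\gcd(m,k_i)=1$ if $B=\mathbb{Z}_m$; $\gcd(2m,k_i)=1$ if $B=2D_{2m}$; $2,3\nmid k_i$ if $B\in\{2T,2O\}$; $2,3,5\nmid k_i$ if $B=2I$.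
   Context: $\mathrm{SU}(2)$ is identified with the unit quaternions. $G=\mathrm{SU}(2)^3$, $K=\Delta(\mathrm{SU}(2))=\{(w,w,w)\}$, $M=G/K\cong S^3\times S^3$; subgroups of $G$ act on $M$ by left translation, and a subgroup acts freely if none of its non-trivial elements fixes a point. A finite subgroup of $G$ is splittable if it is of the form $A_1\times A_2\times A_3$ with non-trivial subgroups $A_i\subset\mathrm{SU}(2)$. ADE groups (every non-trivial finite subgroup of $\mathrm{SU}(2)$ is conjugate to one of them): $\mathbb{Z}_n=\{e^{2\pi i x/n}:x\in\mathbb{Z}\}$, $n\ge2$; $2D_{2n}=\{e^{i\pi x/n}:x\in\mathbb{Z}\}\cup\{je^{i\pi x/n}:x\in\mathbb{Z}\}$, $n\ge2$; $2T=2D_4\cup\{\tfrac12(\pm1\pm i\pm j\pm k)\}$; $2O=2T\cup e^{i\pi/4}\,2T$; $2I=\bigcup_{s=0}^4 q^s\,2T$ with $q=\frac12(\phi+\phi^{-1}i+j)$, $\phi=\frac{1+\sqrt5}{2}$. For $r\in\mathbb{Z}_n^\times$, $\varphi(r)$ is the automorphism $x\mapsto x^r$ of $\mathbb{Z}_n$. For $n>2$ and $(a,b)\in\mathbb{Z}_{2n}^\times\times\mathbb{Z}_{2n}$, $\tau_{a,b}$ is the automorphism of $2D_{2n}$ with $\tau_{a,b}(t^p)=t^{ap}$, $\tau_{a,b}(st^p)=st^{ap+b}$, where $t=e^{i\pi/n}$ and $s=je^{i\pi/n}$. "$2,3\nmid N$" means that none of the listed primes divides $N$; "$a\not\equiv\pm1$"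 means $a$ is congruent neither to $1$ nor to $-1$. *)

theory Defs
  imports Complex_Main "HOL-Number_Theory.Cong" "HOL-Algebra.Left_Coset"
begin

datatype quat = Quat (qre: real) (qi: real) (qj: real) (qk: real)

instantiation quat :: monoid_mult
begin

definition one_quat :: quat where
  "1 = Quat 1 0 0 0"

definition times_quat :: "quat \<Rightarrow> quat \<Rightarrow> quat" where
  "x * y = Quat
     (qre x * qre y - qi x * qi y - qj x * qj y - qk x * qk y)
     (qre x * qi y + qi x * qre y + qj x * qk y - qk x * qj y)
     (qre x * qj y - qi x * qk y + qj x * qre y + qk x * qi y)
     (qre x * qk y + qi x * qj y - qj x * qi y + qk x * qre y)"

instance
  by standard (simp_all add: one_quat_def times_quat_def algebra_simps)

end

definition qnorm_sq :: "quat \<Rightarrow> real" where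
  "qnorm_sq x = (qre x)\<^sup>2 + (qi x)\<^sup>2 + (qj x)\<^sup>2 + (qk x)\<^sup>2"

definition SU2 :: "quat monoid" where
  "SU2 = \<lparr>carrier = {x. qnorm_sq x = 1}, monoid.mult = (*), one = 1\<rparr>"

definition GG :: "(quat \<times> quat \<times> quat) monoid" where
  "GG = SU2 \<times>\<times> SU2 \<times>\<times> SU2"

definition KK :: "(quat \<times> quat \<times> quat) set" where
  "KK = {(w, w, w) | w. w \<in> carrier SU2}"

definition MM :: "(quat \<times> quat \<times> quat) set set" where
  "MM = lcosets\<^bsub>GG\<^esub> KK"

definition acts_freely :: "(quat \<times> quat \<times> quat) set \<Rightarrow> bool" where
  "acts_freely H \<longleftrightarrow> (\<forall>h\<in>H. h \<noteq> \<one>\<^bsub>GG\<^esub> \<longrightarrow> (\<forall>p\<in>MM. h <#\<^bsub>GG\<^esub> p \<noteq> p))"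

definition splittable :: "(quat \<times> quat \<times> quat) set \<Rightarrow> bool" where
  "splittable H \<longleftrightarrow> finite H \<and>
     (\<exists>A1 A2 A3. (\<forall>A\<in>{A1, A2, A3}. subgroup A SU2 \<and> A \<noteq> {\<one>\<^bsub>SU2\<^esub>}) \<and> H = A1 \<times> A2 \<times> A3)"

definition conjugate_subset :: "(quat \<times> quat \<times> quat) \<Rightarrow> (quat \<times> quat \<times> quat) set
    \<Rightarrow> (quat \<times> quat \<times> quat) set" where
  "conjugate_subset g H = (g <#\<^bsub>GG\<^esub> H) #>\<^bsub>GG\<^esub> (inv\<^bsub>GG\<^esub> g)"

text \<open>The circle \<open>e\<^sup>i\<^sup>\<theta>\<close> and the unit \<open>j\<close>.\<close>

definition expi :: "real \<Rightarrow> quat" where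
  "expi \<theta> = Quat (cos \<theta>) (sin \<theta>) 0 0"

definition unit_j :: quat where
  "unit_j = Quat 0 0 1 0"

definition cyc :: "nat \<Rightarrow> quat set" where
  "cyc n = {expi (2 * pi * of_int x / of_nat n) | x :: int. True}"

text \<open>\<open>bin_dihedral n\<close> is \<open>2D\<^bsub>2n\<^esub>\<close>, the binary dihedral group of order \<open>4n\<close>.\<close>

definition bin_dihedral :: "nat \<Rightarrow> quat set" where
  "bin_dihedral n = {expi (pi * of_int x / of_nat n) | x :: int. True}
     \<union> {unit_j * expi (pi * of_int x / of_nat n) | x :: int. True}"

definition bin_tetrahedral :: "quat set" where
  "bin_tetrahedral = bin_dihedral 2
     \<union> {Quat a b c d | a b c d. {a, b, c, d} \<subseteq> {1/2, - 1/2}}"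

definition bin_octahedral :: "quat set" where
  "bin_octahedral = bin_tetrahedral \<union> (\<lambda>x. expi (pi / 4) * x) ` bin_tetrahedral"

definition golden :: real where
  "golden = (1 + sqrt 5) / 2"

definition ico_q :: quat where
  "ico_q = Quat (golden / 2) (inverse golden / 2) (1 / 2) 0"

definition bin_icosahedral :: "quat set" where
  "bin_icosahedral = (\<Union>s\<in>{0..4::nat}. (\<lambda>x. ico_q ^ s * x) ` bin_tetrahedral)"

text \<open>Equality with one of the standard groups, not merely conjugacy to one.\<close>

definition ADE :: "quat set \<Rightarrow> bool" where
  "ADE A \<longleftrightarrow> (\<exists>n\<ge>2. A = cyc n) \<or> (\<exists>n\<ge>2. A = bin_dihedral n)
     \<or> A = bin_tetrahedral \<or> A = bin_octahedral \<or> A = bin_icosahedral"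

text \<open>Only the values on \<open>A\<close> matter: an automorphism of \<open>A\<close> is a total function
  that is unconstrained outside \<open>A\<close>.\<close>

definition automorphisms :: "quat set \<Rightarrow> (quat \<Rightarrow> quat) set" where
  "automorphisms A = iso (SU2\<lparr>carrier := A\<rparr>) (SU2\<lparr>carrier := A\<rparr>)"

definition Graph :: "(quat \<Rightarrow> quat) \<Rightarrow> quat set \<Rightarrow> (quat \<times> quat) set" where
  "Graph \<phi> A = {(x, \<phi> x) | x. x \<in> A}"

text \<open>The product \<open>\<Gamma>(\<phi>, A) \<times> B\<close>, re-associated to a set of triples.\<close>

definition type_I :: "(quat \<Rightarrow> quat) \<Rightarrow> quat set \<Rightarrow> quat set \<Rightarrow> (quat \<times> quat \<times> quat) set" where
  "type_I \<phi> A B = {(x, y, b) | x y b. (x, y) \<in> Graph \<phi> A \<and> b \<in> B}"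

definition power_aut :: "int \<Rightarrow> quat \<Rightarrow> quat" where
  "power_aut r x = x [^]\<^bsub>SU2\<^esub> r"

definition dih_t :: "nat \<Rightarrow> quat" where
  "dih_t n = expi (pi / of_nat n)"

definition dih_s :: "nat \<Rightarrow> quat" where
  "dih_s n = unit_j * expi (pi / of_nat n)"

text \<open>The map \<open>\<tau>\<^bsub>a,b\<^esub>\<close> of \<open>2D\<^bsub>2n\<^esub>\<close>. The description determines a unique value at every
  element of \<open>2D\<^bsub>2n\<^esub>\<close>; see the lemmas \<open>tau_t\<close> and \<open>tau_st\<close> below.\<close>

definition tau :: "nat \<Rightarrow> int \<Rightarrow> int \<Rightarrow> quat \<Rightarrow> quat" where
  "tau n a b x = (THE y. \<exists>p :: int.
     (x = dih_t n [^]\<^bsub>SU2\<^esub> p \<and> y = dih_t n [^]\<^bsub>SU2\<^esub> (a * p)) \<or>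
     (x = dih_s n \<otimes>\<^bsub>SU2\<^esub> (dih_t n [^]\<^bsub>SU2\<^esub> p) \<and>
      y = dih_s n \<otimes>\<^bsub>SU2\<^esub> (dih_t n [^]\<^bsub>SU2\<^esub> (a * p + b))))"

lemma SU2_simps [simp]:
  "carrier SU2 = {x. qnorm_sq x = 1}" "x \<otimes>\<^bsub>SU2\<^esub> y = x * y" "\<one>\<^bsub>SU2\<^esub> = 1"
  by (simp_all add: SU2_def)

lemma qnorm_sq_mult: "qnorm_sq (x * y) = qnorm_sq x * qnorm_sq y"
  by (simp add: qnorm_sq_def times_quat_def power2_eq_square algebra_simps)

lemma group_SU2: "group SU2"
proof (rule groupI)
  fix x assume x: "x \<in> carrier SU2"
  let ?y = "Quat (qre x) (- qi x) (- qj x) (- qk x)"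
  have "?y \<in> carrier SU2" "?y \<otimes>\<^bsub>SU2\<^esub> x = \<one>\<^bsub>SU2\<^esub>"
    using x by (simp_all add: qnorm_sq_def times_quat_def one_quat_def power2_eq_square algebra_simps)
  then show "\<exists>y\<in>carrier SU2. y \<otimes>\<^bsub>SU2\<^esub> x = \<one>\<^bsub>SU2\<^esub>" by blast
next
  show "\<one>\<^bsub>SU2\<^esub> \<in> carrier SU2" by (simp add: one_quat_def qnorm_sq_def)
qed (simp_all add: qnorm_sq_mult mult.assoc)

lemma group_GG: "group GG"
  unfolding GG_def by (intro DirProd_group group_SU2)

lemma expi_carrier: "expi \<theta> \<in> carrier SU2"
  by (simp add: expi_def qnorm_sq_def)

lemma expi_add: "expi (x + y) = expi x * expi y"
  by (simp add: expi_def times_quat_def cos_add sin_add algebra_simps)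

lemma expi_nat_pow: "expi \<theta> [^]\<^bsub>SU2\<^esub> (k :: nat) = expi (of_nat k * \<theta>)"
proof (induction k)
  case 0
  then show ?case by (simp add: expi_def one_quat_def)
next
  case (Suc k)
  then show ?case by (simp add: algebra_simps flip: expi_add)
qed

lemma expi_int_pow: "expi \<theta> [^]\<^bsub>SU2\<^esub> (k :: int) = expi (of_int k * \<theta>)"
proof -
  interpret group SU2 by (rule group_SU2)
  have inv: "inv\<^bsub>SU2\<^esub> (expi x) = expi (- x)" for x
    by (rule inv_equality)
       (use expi_carrier in \<open>auto simp: expi_add [symmetric], simp add: expi_def one_quat_def\<close>)
  show ?thesis
    by (cases k rule: int_cases2)
       (simp_all only: int_pow_int int_pow_neg [OF expi_carrier] expi_nat_pow inv
          of_int_of_nat_eq of_int_minus mult_minus_left)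
qed

lemma dih_disjoint:
  "dih_t n [^]\<^bsub>SU2\<^esub> (p :: int) \<noteq> dih_s n \<otimes>\<^bsub>SU2\<^esub> (dih_t n [^]\<^bsub>SU2\<^esub> (p' :: int))"
proof
  let ?u = "of_int p * (pi / of_nat n)" and ?v = "pi / of_nat n + of_int p' * (pi / of_nat n)"
  assume "dih_t n [^]\<^bsub>SU2\<^esub> p = dih_s n \<otimes>\<^bsub>SU2\<^esub> (dih_t n [^]\<^bsub>SU2\<^esub> p')"
  then have "expi ?u = unit_j * expi ?v"
    by (simp add: dih_t_def dih_s_def expi_int_pow mult.assoc expi_add)
  then have "cos ?u = 0" "sin ?u = 0"
    unfolding expi_def unit_j_def times_quat_def by simp_all
  then show False using sin_cos_squared_add [of ?u] by simp
qed

lemma dih_t_pow_cong: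
  assumes "dih_t n [^]\<^bsub>SU2\<^esub> (p :: int) = dih_t n [^]\<^bsub>SU2\<^esub> (p' :: int)"
  shows "dih_t n [^]\<^bsub>SU2\<^esub> (a * p + b) = dih_t n [^]\<^bsub>SU2\<^esub> (a * p' + b)"
proof -
  interpret group SU2 by (rule group_SU2)
  have c: "dih_t n \<in> carrier SU2" unfolding dih_t_def by (rule expi_carrier)
  have "dih_t n [^]\<^bsub>SU2\<^esub> (p * a) = dih_t n [^]\<^bsub>SU2\<^esub> (p' * a)"
    using assms c by (metis int_pow_pow)
  then show ?thesis
    using int_pow_mult [OF c] by (metis mult.commute)
qed

lemma tau_t: "tau n a b (dih_t n [^]\<^bsub>SU2\<^esub> (p :: int)) = dih_t n [^]\<^bsub>SU2\<^esub> (a * p)"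
  unfolding tau_def
proof (rule the_equality, goal_cases)
  case 1
  then show ?case by blast
next
  case (2 y)
  then show ?case
    using dih_disjoint [of n] dih_t_pow_cong [of n p _ a 0] by (metis add_0_right)
qed

lemma tau_st:
  "tau n a b (dih_s n \<otimes>\<^bsub>SU2\<^esub> (dih_t n [^]\<^bsub>SU2\<^esub> (p :: int))) =
   dih_s n \<otimes>\<^bsub>SU2\<^esub> (dih_t n [^]\<^bsub>SU2\<^esub> (a * p + b))"
proof -
  interpret group SU2 by (rule group_SU2)
  have t: "dih_t n [^]\<^bsub>SU2\<^esub> (k :: int) \<in> carrier SU2" for k
    unfolding dih_t_def by (intro int_pow_closed expi_carrier)
  have "unit_j \<in> carrier SU2" by (simp add: unit_j_def qnorm_sq_def)
  then have s: "dih_s n \<in> carrier SU2"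
    unfolding dih_s_def using m_closed [OF _ expi_carrier] by simp
  have canc: "dih_t n [^]\<^bsub>SU2\<^esub> k = dih_t n [^]\<^bsub>SU2\<^esub> l"
    if "dih_s n \<otimes>\<^bsub>SU2\<^esub> (dih_t n [^]\<^bsub>SU2\<^esub> k) = dih_s n \<otimes>\<^bsub>SU2\<^esub> (dih_t n [^]\<^bsub>SU2\<^esub> l)" for k l :: int
    using that Units_l_cancel [of "dih_s n"] s t unfolding Units_eq by blast
  show ?thesis
    unfolding tau_def
  proof (rule the_equality, goal_cases)
    case 1
    then show ?case by blast
  next
    case (2 y)
    then show ?case
      using dih_disjoint [of n] canc dih_t_pow_cong [of n p _ a b] by metis
  qed
qed

end

theory Submission
  imports Defs
begin

text \<open>Two unit quaternions are conjugate in \<open>SU(2)\<close> exactly when their real parts agree. The stabilisers of points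
of \<open>M = G/K\<close> are the conjugates of the diagonal \<open>K\<close>, so a subgroup of \<open>G\<close> acts freely if and only if it has no
non-trivial element \<open>(x, y, z)\<close> whose three entries have equal real parts (\<open>acts_freely_iff\<close>). This turns
both hypotheses into statements about real parts. Freeness of \<open>\<Gamma>(\<phi>, A) \<times> B\<close> says that no non-trivial \<open>b \<in> B\<close>
has the real part of an \<open>x \<in> A\<close> with \<open>Re \<phi>(x) = Re x\<close>. If \<open>A\<close> and \<open>B\<close> had no common real part other than
\<open>1\<close>, then \<open>A \<times> A \<times> B\<close> would be a freely acting splittable group containing \<open>\<Gamma>(\<phi>, A) \<times> B\<close>; so a common
real part exists, and in particular \<open>\<phi>\<close> does not preserve real parts.

An automorphism respects orders, and in \<open>SU(2)\<close> the orders 1, 2, 3, 4 and 6 determine the real part. A group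
\<open>A\<close> that contains \<open>-1\<close> therefore forces \<open>-1 \<notin> B\<close>, so \<open>B\<close> is cyclic of odd order, and any real part that \<open>B\<close>
shares with \<open>A\<close> belongs to an element of odd order. In the quaternion group \<open>2D\<^sub>4\<close>, in \<open>2T\<close> and in \<open>2O\<close> the
only odd order that a non-trivial element can have is 3, which freeness excludes as well: these groups do not occur as \<open>A\<close>
(\<open>small_orders_in_splittable\<close>). In \<open>2I\<close> the same argument leaves the cyclic groups \<open>B\<close> of odd order prime to 3
(\<open>type_I_icosahedral\<close>).

On the rotations of \<open>A = \<int>\<^sub>n\<close>, or of \<open>A = 2D\<^sub>2\<^sub>n\<close> with \<open>n > 2\<close>, every automorphism is a power map \<open>x \<mapsto> x\<^sup>a\<close>. If
\<open>a \<equiv> \<plusminus>1\<close> it preserves real parts, which is impossible. The rotations whose real part it preserves satisfy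
\<open>x\<^sup>a = x\<^sup>-\<^sup>1\<close> or \<open>x\<^sup>a = x\<close>; they form the subgroups of orders \<open>gcd (1 + a) N\<close> and \<open>gcd (1 - a) N\<close>, where \<open>N\<close> is the
number of rotations. Freeness forbids \<open>B\<close> to have a non-trivial order in common with them
(\<open>free_no_fixed_root\<close>), and these are the stated coprimality conditions. Every automorphism of \<open>2D\<^sub>2\<^sub>n\<close> is a
\<open>\<tau>\<^sub>a\<^sub>,\<^sub>b\<close> (\<open>automorphism_bin_dihedral\<close>). Since \<open>A\<close> and \<open>B\<close> are the standard groups themselves, the
conjugating element can be the identity throughout.\<close>

section \<open>Unit quaternions and their real parts\<close>

definition qcnj :: "quat \<Rightarrow> quat" where
  "qcnj x = Quat (qre x) (- qi x) (- qj x) (- qk x)"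

lemma qnorm_sq_qcnj [simp]: "qnorm_sq (qcnj x) = qnorm_sq x"
  by (simp add: qcnj_def qnorm_sq_def)

lemma mult_qcnj:
  assumes "qnorm_sq x = 1"
  shows "x * qcnj x = 1" "qcnj x * x = 1"
  using assms
  by (simp_all add: qcnj_def qnorm_sq_def times_quat_def one_quat_def power2_eq_square algebra_simps)

lemma qnorm_sq_one [simp]: "qnorm_sq 1 = 1"
  by (simp add: qnorm_sq_def one_quat_def)

lemma qre_one [simp]: "qre 1 = 1"
  by (simp add: one_quat_def)

lemma unit_eq_one_iff:
  assumes "qnorm_sq x = 1"
  shows "x = 1 \<longleftrightarrow> qre x = 1"
proof
  assume "qre x = 1"
  then have "(qi x)\<^sup>2 + (qj x)\<^sup>2 + (qk x)\<^sup>2 = 0" using assms by (simp add: qnorm_sq_def)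
  then have "qi x = 0 \<and> qj x = 0 \<and> qk x = 0"
    by (smt (verit) zero_le_power2 power2_eq_iff_nonneg zero_eq_power2)
  then show "x = 1" using \<open>qre x = 1\<close> by (simp add: one_quat_def quat.expand)
qed simp

definition minus_one :: quat where
  "minus_one = Quat (- 1) 0 0 0"

lemma minus_one_simps [simp]:
  "qnorm_sq minus_one = 1" "minus_one * minus_one = 1" "minus_one \<noteq> 1" "qre minus_one = - 1"
  by (simp_all add: minus_one_def qnorm_sq_def times_quat_def one_quat_def)

lemma unit_eq_minus_one:
  assumes "qnorm_sq x = 1" "qre x = - 1"
  shows "x = minus_one"
proof -
  have "(qi x)\<^sup>2 + (qj x)\<^sup>2 + (qk x)\<^sup>2 = 0" using assms by (simp add: qnorm_sq_def)
  then have "qi x = 0 \<and> qj x = 0 \<and> qk x = 0"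
    by (smt (verit) zero_le_power2 power2_eq_iff_nonneg zero_eq_power2)
  then show ?thesis using assms by (simp add: minus_one_def quat.expand)
qed

text \<open>The real part of a power of a unit quaternion is a polynomial in the real part of the quaternion. Orders can
therefore be read off from real parts; squares and cubes suffice below.\<close>

lemma unit_square:
  assumes "qnorm_sq x = 1"
  shows "qre (x * x) = 2 * (qre x)\<^sup>2 - 1"
  using assms by (simp add: times_quat_def qnorm_sq_def power2_eq_square)

lemma unit_involution:
  assumes "qnorm_sq x = 1" "x * x = 1" "x \<noteq> 1"
  shows "x = minus_one"
proof -
  have "(qre x)\<^sup>2 = 1" using unit_square [OF assms(1)] assms(2) by simp
  then show ?thesis
    using assms unit_eq_one_iff unit_eq_minus_one by (auto simp: power2_eq_1_iff)
qed

lemma qre_conjugate: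
  assumes "qnorm_sq g = 1" "x * g = g * w"
  shows "qre x = qre w"
proof -
  have "qre (x * g * qcnj g) = qre x * qnorm_sq g"
    by (simp add: times_quat_def qcnj_def qnorm_sq_def power2_eq_square algebra_simps)
  moreover have "qre (g * w * qcnj g) = qre w * qnorm_sq g"
    by (simp add: times_quat_def qcnj_def qnorm_sq_def power2_eq_square algebra_simps)
  ultimately show ?thesis using assms by simp
qed

lemma qnorm_sq_pos: "h \<noteq> Quat 0 0 0 0 \<Longrightarrow> qnorm_sq h > 0"
  by (cases h) (auto simp: qnorm_sq_def add_nonneg_eq_0_iff less_le intro!: add_nonneg_nonneg)

text \<open>Write \<open>x = c + u\<close> and \<open>y = c + v\<close> with pure parts of equal length \<open>s\<close>, so that \<open>u\<^sup>2 = v\<^sup>2 = - s\<^sup>2\<close>. Then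
\<open>v (u + v) = v u - s\<^sup>2 = (u + v) u\<close>, and the normalised \<open>u + v\<close> conjugates \<open>x\<close> to \<open>y\<close>, being the half-turn about
the bisector. If \<open>u + v = 0\<close>, a pure quaternion orthogonal to \<open>u\<close> anticommutes with \<open>u\<close> and does the job.\<close>

lemma unit_conjugate:
  assumes "qnorm_sq x = 1" "qnorm_sq y = 1" "qre x = qre y"
  shows "\<exists>g. qnorm_sq g = 1 \<and> y * g = g * x"
proof -
  obtain c a1 a2 a3 where x: "x = Quat c a1 a2 a3" by (cases x)
  obtain b1 b2 b3 where y: "y = Quat c b1 b2 b3" using assms(3) x by (cases y) auto
  have n: "a1\<^sup>2 + a2\<^sup>2 + a3\<^sup>2 = b1\<^sup>2 + b2\<^sup>2 + b3\<^sup>2"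
    using assms(1,2) by (simp add: x y qnorm_sq_def)
  have "\<exists>h. h \<noteq> Quat 0 0 0 0 \<and> y * h = h * x"
  proof (cases "a1 + b1 = 0 \<and> a2 + b2 = 0 \<and> a3 + b3 = 0")
    case False
    then show ?thesis using n
      by (intro exI [of _ "Quat 0 (a1 + b1) (a2 + b2) (a3 + b3)"])
        (simp add: x y times_quat_def power2_eq_square algebra_simps)
  next
    case True
    then have b: "b1 = - a1" "b2 = - a2" "b3 = - a3" by auto
    show ?thesis
    proof (cases "a1 = 0 \<and> a2 = 0")
      case True
      then show ?thesis
        by (intro exI [of _ "Quat 0 1 0 0"]) (simp add: x y b times_quat_def)
    next
      case False
      then show ?thesis
        by (intro exI [of _ "Quat 0 a2 (- a1) 0"]) (auto simp: x y b times_quat_def algebra_simps)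
    qed
  qed
  then obtain h where h: "h \<noteq> Quat 0 0 0 0" "y * h = h * x" by blast
  define r where "r = sqrt (qnorm_sq h)"
  have r: "r > 0" "r\<^sup>2 = qnorm_sq h" using qnorm_sq_pos [OF h(1)] by (simp_all add: r_def)
  define g where "g = Quat (inverse r) 0 0 0 * h"
  have "qnorm_sq g = 1"
  proof -
    have "qnorm_sq g = (inverse r)\<^sup>2 * r\<^sup>2"
      unfolding g_def qnorm_sq_mult r(2) by (simp add: qnorm_sq_def)
    then show ?thesis using r(1) by (simp flip: power_mult_distrib)
  qed
  moreover have "y * Quat (inverse r) 0 0 0 = Quat (inverse r) 0 0 0 * y"
    by (simp add: times_quat_def)
  then have "y * g = g * x"
    using h(2) unfolding g_def by (metis mult.assoc)
  ultimately show ?thesis by blast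
qed

section \<open>Free actions in terms of real parts\<close>

lemma GG_simps [simp]:
  "(x, y, z) \<in> carrier GG \<longleftrightarrow> qnorm_sq x = 1 \<and> qnorm_sq y = 1 \<and> qnorm_sq z = 1"
  "(x, y, z) \<otimes>\<^bsub>GG\<^esub> (x', y', z') = (x * x', y * y', z * z')"
  "\<one>\<^bsub>GG\<^esub> = (1, 1, 1)"
  by (simp_all add: GG_def)

text \<open>An element \<open>(x, y, z)\<close> fixes the coset of \<open>(g\<^sub>1, g\<^sub>2, g\<^sub>3)\<close> if and only if the \<open>g\<^sub>i\<close> conjugate its three
entries into one and the same quaternion. Requiring \<open>z = 1\<close> suffices in the criterion, because a unit
quaternion with real part 1 is 1.\<close>

lemma acts_freely_iff:
  assumes "H \<subseteq> carrier GG"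
  shows "acts_freely H \<longleftrightarrow>
    (\<forall>x y z. (x, y, z) \<in> H \<longrightarrow> qre x = qre z \<longrightarrow> qre y = qre z \<longrightarrow> z = 1)"
    (is "?L \<longleftrightarrow> ?R")
proof
  assume free: ?L
  show ?R
  proof (intro allI impI, rule ccontr)
    fix x y z assume h: "(x, y, z) \<in> H" "qre x = qre z" "qre y = qre z" "z \<noteq> 1"
    have n: "qnorm_sq x = 1" "qnorm_sq y = 1" "qnorm_sq z = 1" using h(1) assms by auto
    obtain g1 where g1: "qnorm_sq g1 = 1" "x * g1 = g1 * z" using unit_conjugate n h by metis
    obtain g2 where g2: "qnorm_sq g2 = 1" "y * g2 = g2 * z" using unit_conjugate n h by metis
    \<comment> \<open>All three entries are conjugated to \<open>z\<close>, the third one by 1.\<close>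
    let ?g = "(g1, g2, 1 :: quat)"
    define p where "p = ?g <#\<^bsub>GG\<^esub> KK"
    have p: "p = {(g1 * w, g2 * w, w) | w. qnorm_sq w = 1}"
      by (auto simp: p_def l_coset_def KK_def)
    have "p \<in> MM" using g1 g2 by (auto simp: MM_def LCOSETS_def p_def)
    have shift: "(x, y, z) \<otimes>\<^bsub>GG\<^esub> (g1 * w, g2 * w, w) = (g1 * (z * w), g2 * (z * w), z * w)" for w
      using g1(2) g2(2) by (simp flip: mult.assoc)
    have "(x, y, z) <#\<^bsub>GG\<^esub> p = p"
    proof (intro equalityI subsetI)
      fix u assume "u \<in> (x, y, z) <#\<^bsub>GG\<^esub> p"
      then obtain w where "qnorm_sq w = 1" "u = (g1 * (z * w), g2 * (z * w), z * w)"
        unfolding p l_coset_def using shift by auto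
      moreover have "qnorm_sq (z * w) = 1" using n calculation by (simp add: qnorm_sq_mult)
      ultimately show "u \<in> p" unfolding p by blast
    next
      fix u assume "u \<in> p"
      then obtain w where w: "qnorm_sq w = 1" "u = (g1 * w, g2 * w, w)" unfolding p by blast
      let ?v = "qcnj z * w"
      have "z * ?v = w" using mult_qcnj(1) [OF n(3)] by (simp flip: mult.assoc)
      then have "u = (x, y, z) \<otimes>\<^bsub>GG\<^esub> (g1 * ?v, g2 * ?v, ?v)" using shift w(2) by metis
      moreover have "(g1 * ?v, g2 * ?v, ?v) \<in> p"
        unfolding p using n w(1) by (auto simp: qnorm_sq_mult)
      ultimately show "u \<in> (x, y, z) <#\<^bsub>GG\<^esub> p" unfolding l_coset_def by blast
    qed
    moreover have "(x, y, z) \<noteq> \<one>\<^bsub>GG\<^esub>" using h(4) by simp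
    ultimately show False using free h(1) \<open>p \<in> MM\<close> unfolding acts_freely_def by blast
  qed
next
  assume re: ?R
  show ?L
    unfolding acts_freely_def
  proof (intro ballI impI notI)
    fix h p assume h: "h \<in> H" "h \<noteq> \<one>\<^bsub>GG\<^esub>" and p: "p \<in> MM" "h <#\<^bsub>GG\<^esub> p = p"
    obtain x y z where xyz: "h = (x, y, z)" by (cases h) auto
    have n: "qnorm_sq x = 1" "qnorm_sq y = 1" "qnorm_sq z = 1" using h(1) xyz assms by auto
    obtain g1 g2 g3 where g: "qnorm_sq g1 = 1" "qnorm_sq g2 = 1" "qnorm_sq g3 = 1"
      and pg: "p = (g1, g2, g3) <#\<^bsub>GG\<^esub> KK"
      using p(1) by (auto simp: MM_def LCOSETS_def)
    have p_eq: "p = {(g1 * w, g2 * w, g3 * w) | w. qnorm_sq w = 1}"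
      by (auto simp: pg l_coset_def KK_def)
    have "(g1, g2, g3) \<in> p"
      unfolding p_eq by (rule CollectI, rule exI [of _ 1]) simp
    then have "h \<otimes>\<^bsub>GG\<^esub> (g1, g2, g3) \<in> h <#\<^bsub>GG\<^esub> p" by (auto simp: l_coset_def)
    then have "(x * g1, y * g2, z * g3) \<in> p" using p(2) xyz by simp
    then obtain w where "x * g1 = g1 * w" "y * g2 = g2 * w" "z * g3 = g3 * w"
      unfolding p_eq by auto
    then have r: "qre x = qre w" "qre y = qre w" "qre z = qre w"
      using g qre_conjugate by blast+
    then have "z = 1" using re h(1) xyz by auto
    then have "qre x = 1" "qre y = 1" using r by auto
    then show False using h(2) n \<open>z = 1\<close> xyz by (simp add: unit_eq_one_iff)
  qed
qed

lemma conjugate_subset_one: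
  assumes "H \<subseteq> carrier GG"
  shows "conjugate_subset (1, 1, 1) H = H"
proof -
  interpret group GG by (rule group_GG)
  have "conjugate_subset \<one>\<^bsub>GG\<^esub> H = H"
    unfolding conjugate_subset_def using assms by (simp only: lcos_mult_one inv_one coset_mult_one)
  then show ?thesis by simp
qed

section \<open>Automorphisms of subgroups of SU(2)\<close>

lemma type_I_iff: "(x, y, b) \<in> type_I \<phi> A B \<longleftrightarrow> x \<in> A \<and> y = \<phi> x \<and> b \<in> B"
  by (auto simp: type_I_def Graph_def)

lemma type_I_carrier:
  assumes "A \<subseteq> carrier SU2" "B \<subseteq> carrier SU2" "\<phi> ` A \<subseteq> A"
  shows "type_I \<phi> A B \<subseteq> carrier GG"
  using assms by (fastforce simp: type_I_def Graph_def)

lemma type_I_cong: "(\<And>x. x \<in> A \<Longrightarrow> \<phi> x = \<psi> x) \<Longrightarrow> type_I \<phi> A B = type_I \<psi> A B"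
  by (auto simp: type_I_def Graph_def)

lemma automorphism_mult:
  "\<phi> \<in> automorphisms A \<Longrightarrow> x \<in> A \<Longrightarrow> y \<in> A \<Longrightarrow> \<phi> (x * y) = \<phi> x * \<phi> y"
  by (simp add: automorphisms_def iso_def hom_def)

lemma automorphism_bij: "\<phi> \<in> automorphisms A \<Longrightarrow> bij_betw \<phi> A A"
  by (simp add: automorphisms_def iso_def)

lemma automorphism_image: "\<phi> \<in> automorphisms A \<Longrightarrow> \<phi> ` A = A"
  using automorphism_bij bij_betw_imp_surj_on by blast

lemma automorphism_one:
  assumes "subgroup A SU2" "\<phi> \<in> automorphisms A"
  shows "\<phi> 1 = 1"
proof -
  have 1: "1 \<in> A" using subgroup.one_closed [OF assms(1)] by simp
  then have "\<phi> 1 * \<phi> 1 = \<phi> 1" using automorphism_mult [OF assms(2) 1 1] by simp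
  moreover have "\<phi> 1 \<in> A" using automorphism_image [OF assms(2)] 1 by blast
  then have "qnorm_sq (\<phi> 1) = 1" using subgroup.subset [OF assms(1)] by auto
  ultimately show ?thesis by (metis mult_qcnj(1) mult.assoc mult_1_right)
qed

lemma automorphism_eq_one_iff:
  assumes "subgroup A SU2" "\<phi> \<in> automorphisms A" "x \<in> A"
  shows "\<phi> x = 1 \<longleftrightarrow> x = 1"
proof -
  have "1 \<in> A" using subgroup.one_closed [OF assms(1)] by simp
  then show ?thesis
    using automorphism_one [OF assms(1,2)] automorphism_bij [OF assms(2)] assms(3)
    by (metis bij_betw_imp_inj_on inj_onD)
qed

lemma subgroup_mult: "subgroup A SU2 \<Longrightarrow> x \<in> A \<Longrightarrow> y \<in> A \<Longrightarrow> x * y \<in> A"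
  using subgroup.m_closed [of A SU2 x y] by simp

lemma subgroup_unit: "subgroup A SU2 \<Longrightarrow> x \<in> A \<Longrightarrow> qnorm_sq x = 1"
  using subgroup.subset [of A SU2] by auto

text \<open>The quaternion \<open>-1\<close> is the only element of order 2 of \<open>SU(2)\<close>.\<close>

lemma automorphism_minus_one:
  assumes "subgroup A SU2" "\<phi> \<in> automorphisms A" "minus_one \<in> A"
  shows "\<phi> minus_one = minus_one"
proof (rule unit_involution)
  show "qnorm_sq (\<phi> minus_one) = 1"
    using assms automorphism_image subgroup_unit by blast
  show "\<phi> minus_one * \<phi> minus_one = 1"
    using automorphism_mult [OF assms(2,3,3)] automorphism_one [OF assms(1,2)] by simp
  show "\<phi> minus_one \<noteq> 1" using automorphism_eq_one_iff [OF assms] by simp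
qed

lemma qre_cube:
  assumes "qnorm_sq x = 1"
  shows "qre (x * x * x) = 4 * qre x ^ 3 - 3 * qre x"
proof -
  have n: "qi x * qi x + qj x * qj x + qk x * qk x = 1 - qre x * qre x"
    using assms by (simp add: qnorm_sq_def power2_eq_square)
  have "qre (x * x * x) = qre x * (qre x * qre x) - 3 * qre x * (qi x * qi x + qj x * qj x + qk x * qk x)"
    by (simp add: times_quat_def algebra_simps)
  also have "\<dots> = 4 * qre x ^ 3 - 3 * qre x"
    unfolding n by (simp add: power3_eq_cube algebra_simps)
  finally show ?thesis .
qed

lemma unit_cube_eq_one_iff:
  assumes "qnorm_sq x = 1"
  shows "x * x * x = 1 \<longleftrightarrow> x = 1 \<or> qre x = - 1 / 2"
proof -
  have "qre (x * x * x) = (qre x - 1) * (2 * qre x + 1)\<^sup>2 + 1"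
    unfolding qre_cube [OF assms] by (simp add: power2_eq_square power3_eq_cube algebra_simps)
  then have "qre (x * x * x) = 1 \<longleftrightarrow> qre x = 1 \<or> qre x = - 1 / 2" by auto
  then show ?thesis using assms by (simp add: unit_eq_one_iff qnorm_sq_mult)
qed

text \<open>The elements of order 3 are exactly those with real part \<open>-1/2\<close>, and an automorphism permutes them.\<close>

lemma automorphism_re_order_three:
  assumes "subgroup A SU2" "\<phi> \<in> automorphisms A" "x \<in> A" "qre x = - 1 / 2"
  shows "qre (\<phi> x) = - 1 / 2"
proof -
  have n: "qnorm_sq x = 1" "qnorm_sq (\<phi> x) = 1"
    using assms automorphism_image subgroup_unit by blast+
  have "x * x * x = 1" using unit_cube_eq_one_iff [OF n(1)] assms(4) by simp
  then have "\<phi> x * \<phi> x * \<phi> x = 1"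
    using automorphism_mult [OF assms(2)] subgroup_mult [OF assms(1)] assms(3)
      automorphism_one [OF assms(1,2)] by metis
  moreover have "x \<noteq> 1" using assms(4) by auto
  then have "\<phi> x \<noteq> 1" using automorphism_eq_one_iff [OF assms(1-3)] by simp
  ultimately show ?thesis using unit_cube_eq_one_iff [OF n(2)] by simp
qed

lemma free_type_I_no_common_re:
  assumes "subgroup A SU2" "subgroup B SU2" "\<phi> \<in> automorphisms A"
    and "acts_freely (type_I \<phi> A B)"
    and "x \<in> A" "b \<in> B" "qre (\<phi> x) = qre b" "qre x = qre b"
  shows "b = 1"
proof -
  have "type_I \<phi> A B \<subseteq> carrier GG"
    by (intro type_I_carrier subgroup.subset assms) (simp add: automorphism_image assms)
  moreover have "(x, \<phi> x, b) \<in> type_I \<phi> A B" using assms by (simp add: type_I_iff)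
  ultimately show ?thesis using acts_freely_iff assms by blast
qed

text \<open>The group \<open>A \<times> A \<times> B\<close> is splittable and contains \<open>\<Gamma>(\<phi>, A) \<times> B\<close>, so by assumption it does not act freely;
an element with a fixed point provides the common real part.\<close>

lemma common_re_if_not_in_free_splittable:
  assumes "subgroup A SU2" "finite A" "A \<noteq> {1}"
    and "subgroup B SU2" "finite B" "B \<noteq> {1}"
    and "\<phi> \<in> automorphisms A"
    and "\<not> (\<exists>H. splittable H \<and> acts_freely H \<and> type_I \<phi> A B \<subseteq> H)"
  obtains x b where "x \<in> A" "b \<in> B" "qre x = qre b" "b \<noteq> 1"
proof -
  have "splittable (A \<times> A \<times> B)" unfolding splittable_def using assms by auto
  moreover have "type_I \<phi> A B \<subseteq> A \<times> A \<times> B"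
    using automorphism_image [OF assms(7)] by (auto simp: type_I_def Graph_def)
  ultimately have "\<not> acts_freely (A \<times> A \<times> B)" using assms(8) by blast
  moreover have "A \<times> A \<times> B \<subseteq> carrier GG" using assms subgroup_unit by auto
  ultimately show ?thesis using acts_freely_iff that by blast
qed

section \<open>Roots of unity, cyclic and binary dihedral groups\<close>

text \<open>The rotation group \<open>\<int>\<^sub>n\<close> is parametrised by integer exponents modulo \<open>n\<close>, which reduces computations in the
cyclic and binary dihedral groups to congruences.\<close>

definition zeta :: "nat \<Rightarrow> int \<Rightarrow> quat" where
  "zeta n x = expi (2 * pi * of_int x / of_nat n)"

lemma zeta_unit [simp]: "qnorm_sq (zeta n x) = 1"
  using expi_carrier by (simp add: zeta_def)

lemma zeta_0 [simp]: "zeta n 0 = 1"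
  by (simp add: zeta_def expi_def one_quat_def)

lemma zeta_add: "zeta n (x + y) = zeta n x * zeta n y"
  unfolding zeta_def by (simp add: ring_distribs add_divide_distrib flip: expi_add)

lemma expi_eq_iff: "expi a = expi b \<longleftrightarrow> (\<exists>k::int. a = b + 2 * pi * k)"
  using sin_cos_eq_iff [of a b] by (auto simp: expi_def)

lemma zeta_eq_iff:
  assumes "n > 0"
  shows "zeta n x = zeta n y \<longleftrightarrow> [x = y] (mod int n)"
proof -
  have "2 * pi * of_int x / of_nat n = 2 * pi * of_int y / of_nat n + 2 * pi * of_int k
      \<longleftrightarrow> x = y + int n * k" for k :: int
  proof -
    have "2 * pi * of_int x / of_nat n = 2 * pi * of_int y / of_nat n + 2 * pi * of_int k
      \<longleftrightarrow> (of_int x :: real) = of_int (y + int n * k)"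
    proof -
      have "2 * pi * of_int x / of_nat n = 2 * pi * of_int y / of_nat n + 2 * pi * of_int k
        \<longleftrightarrow> 2 * pi * (of_int x :: real) = 2 * pi * of_int (y + int n * k)"
        using assms by (simp add: field_simps)
      then show ?thesis by (simp only: mult_cancel_left) simp
    qed
    then show ?thesis by (simp only: of_int_eq_iff)
  qed
  then have "zeta n x = zeta n y \<longleftrightarrow> (\<exists>k. x = y + int n * k)"
    unfolding zeta_def expi_eq_iff by blast
  also have "\<dots> \<longleftrightarrow> [x = y] (mod int n)"
    by (metis cong_iff_lin cong_sym_eq mult.commute)
  finally show ?thesis .
qed

lemma qre_zeta_uminus [simp]: "qre (zeta n (- x)) = qre (zeta n x)"
  by (simp add: zeta_def expi_def)

lemma zeta_scale:
  assumes "d > 0"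
  shows "zeta (n * d) (x * int d) = zeta n x"
  using assms by (simp add: zeta_def field_simps)

lemma cyc_zeta: "cyc n = range (zeta n)"
  by (auto simp: cyc_def zeta_def)

lemma zeta_double: "expi (pi * of_int x / of_nat n) = zeta (2 * n) x"
  by (simp add: zeta_def)

lemma bin_dihedral_zeta:
  "bin_dihedral n = range (zeta (2 * n)) \<union> (\<lambda>x. unit_j * zeta (2 * n) x) ` UNIV"
  unfolding bin_dihedral_def zeta_double by auto

lemma unit_j_unit [simp]: "qnorm_sq unit_j = 1"
  by (simp add: unit_j_def qnorm_sq_def)

lemma zeta_unit_j: "zeta n x * unit_j = unit_j * zeta n (- x)"
  by (simp add: zeta_def expi_def unit_j_def times_quat_def)

lemma unit_j_sq: "unit_j * unit_j = minus_one"
  by (simp add: unit_j_def minus_one_def times_quat_def)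

lemma zeta_half: "n > 0 \<Longrightarrow> zeta (2 * n) (int n) = minus_one"
  by (simp add: zeta_def expi_def minus_one_def)

lemma qre_unit_j_zeta [simp]: "qre (unit_j * zeta n x) = 0"
  by (simp add: zeta_def expi_def unit_j_def times_quat_def)

lemma finite_range_zeta:
  assumes "n > 0"
  shows "finite (range (zeta n))"
proof -
  have "range (zeta n) \<subseteq> zeta n ` {0..<int n}"
  proof
    fix y assume "y \<in> range (zeta n)"
    then obtain x where "y = zeta n x" by blast
    then have "y = zeta n (x mod int n)" using assms by (simp add: zeta_eq_iff cong_def)
    then show "y \<in> zeta n ` {0..<int n}" using assms by auto
  qed
  then show ?thesis by (rule finite_subset) simp
qed

text \<open>Left multiplication by an element of \<open>X\<close> is injective, hence surjective on the finite set \<open>X\<close>, and so reaches 1.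
For the polyhedral groups only closure under multiplication remains to be checked.\<close>

lemma finite_mult_closed_subgroup:
  assumes "finite X" "1 \<in> X" "\<And>x. x \<in> X \<Longrightarrow> qnorm_sq x = 1"
    and "\<And>x y. x \<in> X \<Longrightarrow> y \<in> X \<Longrightarrow> x * y \<in> X"
  shows "subgroup X SU2"
proof -
  interpret group SU2 by (rule group_SU2)
  show ?thesis
  proof (rule subgroupI)
    fix x assume x: "x \<in> X"
    have "inj_on (\<lambda>y. x * y) X"
      by (rule inj_on_inverseI [of _ "\<lambda>y. qcnj x * y"])
        (simp add: mult_qcnj(2) assms(3) x flip: mult.assoc)
    moreover have "(\<lambda>y. x * y) ` X \<subseteq> X" using assms(4) x by blast
    ultimately have "(\<lambda>y. x * y) ` X = X" using assms(1) by (simp add: endo_inj_surj)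
    then obtain y where y: "y \<in> X" "x * y = 1" using assms(2) by force
    then have "inv\<^bsub>SU2\<^esub> x = y"
      using x assms(3) inv_comm [of x y] by (intro inv_equality) simp_all
    then show "inv\<^bsub>SU2\<^esub> x \<in> X" using y by simp
  qed (use assms in auto)
qed

lemma subgroup_cyc:
  assumes "n > 0"
  shows "subgroup (cyc n) SU2" "finite (cyc n)"
proof -
  show fin: "finite (cyc n)" unfolding cyc_zeta by (rule finite_range_zeta [OF assms])
  have "1 \<in> cyc n" unfolding cyc_zeta by (metis rangeI zeta_0)
  then show "subgroup (cyc n) SU2"
    by (rule finite_mult_closed_subgroup [OF fin]) (auto simp: cyc_zeta simp flip: zeta_add)
qed

lemma subgroup_bin_dihedral:
  assumes "n > 0"
  shows "subgroup (bin_dihedral n) SU2" "finite (bin_dihedral n)"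
proof -
  show fin: "finite (bin_dihedral n)"
    unfolding bin_dihedral_zeta using finite_range_zeta [of "2 * n"] assms
    by (auto simp: image_image [of "\<lambda>y. unit_j * y" "zeta (2 * n)", symmetric])
  have "1 \<in> bin_dihedral n" unfolding bin_dihedral_zeta by (metis rangeI zeta_0 UnI1)
  moreover have "x * y \<in> bin_dihedral n" if "x \<in> bin_dihedral n" "y \<in> bin_dihedral n" for x y
  proof -
    let ?z = "zeta (2 * n)"
    have 1: "?z a * (unit_j * ?z b) = unit_j * ?z (- a + b)" for a b
      unfolding zeta_add by (simp add: mult.assoc [symmetric] zeta_unit_j)
    have 2: "(unit_j * ?z a) * (unit_j * ?z b) = ?z (int n + (- a + b))" for a b
    proof -
      have "(unit_j * ?z a) * (unit_j * ?z b) = unit_j * unit_j * ?z (- a + b)"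
        using 1 [of a b] by (simp add: mult.assoc)
      then show ?thesis using assms by (simp only: unit_j_sq zeta_add zeta_half)
    qed
    show ?thesis
      using that 1 2 unfolding bin_dihedral_zeta
      by (elim UnE imageE) (auto simp: mult.assoc simp del: zeta_add simp flip: zeta_add)
  qed
  ultimately show "subgroup (bin_dihedral n) SU2"
    by (intro finite_mult_closed_subgroup [OF fin]) (auto simp: bin_dihedral_zeta qnorm_sq_mult)
qed

lemma quaternion_group:
  "bin_dihedral 2 = {Quat 1 0 0 0, Quat (- 1) 0 0 0, Quat 0 1 0 0, Quat 0 (- 1) 0 0,
     Quat 0 0 1 0, Quat 0 0 (- 1) 0, Quat 0 0 0 1, Quat 0 0 0 (- 1)}" (is "_ = ?Q")
proof -
  let ?z = "zeta (2 * 2)"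
  have v: "?z 0 = Quat 1 0 0 0" "?z 1 = Quat 0 1 0 0" "?z 2 = Quat (- 1) 0 0 0"
    "?z 3 = Quat 0 (- 1) 0 0"
  proof -
    show "?z 0 = Quat 1 0 0 0" "?z 1 = Quat 0 1 0 0" "?z 2 = Quat (- 1) 0 0 0"
      by (simp_all add: zeta_def expi_def one_quat_def)
    show "?z 3 = Quat 0 (- 1) 0 0"
      using cos_periodic_pi [of "pi / 2"] sin_periodic_pi [of "pi / 2"]
      unfolding zeta_def expi_def by (simp add: add.commute)
  qed
  have "range ?z = ?z ` {0, 1, 2, 3}"
  proof
    show "range ?z \<subseteq> ?z ` {0, 1, 2, 3}"
    proof
      fix y assume "y \<in> range ?z"
      then obtain x where "y = ?z x" by blast
      then have "y = ?z (x mod 4)" using zeta_eq_iff [of "2 * 2" x "x mod 4"] by (simp add: cong_def)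
      moreover have "x mod 4 = 0 \<or> x mod 4 = 1 \<or> x mod 4 = 2 \<or> x mod 4 = 3" by presburger
      ultimately show "y \<in> ?z ` {0, 1, 2, 3}" by auto
    qed
  qed blast
  then have r: "range ?z = {Quat 1 0 0 0, Quat 0 1 0 0, Quat (- 1) 0 0 0, Quat 0 (- 1) 0 0}"
    by (simp only: image_insert image_empty v)
  have "(\<lambda>x. unit_j * ?z x) ` UNIV = (\<lambda>y. unit_j * y) ` range ?z" by (simp add: image_image)
  also have "\<dots> = {Quat 0 0 1 0, Quat 0 0 0 (- 1), Quat 0 0 (- 1) 0, Quat 0 0 0 1}"
    unfolding r by (simp add: unit_j_def times_quat_def)
  finally show ?thesis unfolding bin_dihedral_zeta r by auto
qed

section \<open>The binary polyhedral groups\<close>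

lemma bin_tetrahedral_cases:
  assumes "Quat a b c d \<in> bin_tetrahedral"
  obtains "Quat a b c d \<in> bin_dihedral 2"
  | "(a = 1/2 \<or> a = - 1/2) \<and> (b = 1/2 \<or> b = - 1/2) \<and> (c = 1/2 \<or> c = - 1/2) \<and> (d = 1/2 \<or> d = - 1/2)"
  using assms unfolding bin_tetrahedral_def by auto

lemma bin_tetrahedral_halfI:
  assumes "\<bar>a\<bar> = 1/2" "\<bar>b\<bar> = 1/2" "\<bar>c\<bar> = 1/2" "\<bar>d\<bar> = 1/2"
  shows "Quat a b c d \<in> bin_tetrahedral"
proof -
  have "t \<in> {1/2, - 1/2}" if "\<bar>t\<bar> = 1/2" for t :: real
    using that by (simp add: abs_if split: if_splits)
  then have "{a, b, c, d} \<subseteq> {1/2, - 1/2}" using assms by blast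
  then show ?thesis unfolding bin_tetrahedral_def by blast
qed

lemma bin_tetrahedral_dihedralI: "x \<in> bin_dihedral 2 \<Longrightarrow> x \<in> bin_tetrahedral"
  by (simp add: bin_tetrahedral_def)

text \<open>The group \<open>2T\<close> is generated by \<open>i\<close> and \<open>\<omega> = (1 + i + j + k)/2\<close>. In this form the fact shows closure under
multiplication: a set that is stable under left multiplication by \<open>i\<close> and \<open>\<omega>\<close> is stable under all of \<open>2T\<close>.\<close>

lemma bin_tetrahedral_induct [consumes 1, case_names one i w]:
  assumes "x \<in> bin_tetrahedral"
    and one: "P 1"
    and i: "\<And>x. P x \<Longrightarrow> P (Quat 0 1 0 0 * x)"
    and w: "\<And>x. P x \<Longrightarrow> P (Quat (1/2) (1/2) (1/2) (1/2) * x)"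
  shows "P x"
proof -
  \<comment> \<open>Each of the 24 elements is \<open>i\<close> or \<open>\<omega>\<close> times an earlier one.\<close>
  have p0: "P (Quat 1 0 0 0)" using one by (simp add: one_quat_def)
  have p1: "P (Quat 0 1 0 0)" using i [OF p0] by (simp add: times_quat_def)
  have p2: "P (Quat (1/2) (1/2) (1/2) (1/2))" using w [OF p0] by (simp add: times_quat_def)
  have p3: "P (Quat (-1) 0 0 0)" using i [OF p1] by (simp add: times_quat_def)
  have p4: "P (Quat (-1/2) (1/2) (1/2) (-1/2))" using w [OF p1] by (simp add: times_quat_def)
  have p5: "P (Quat (-1/2) (1/2) (-1/2) (1/2))" using i [OF p2] by (simp add: times_quat_def)
  have p6: "P (Quat (-1/2) (1/2) (1/2) (1/2))" using w [OF p2] by (simp add: times_quat_def)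
  have p7: "P (Quat 0 (-1) 0 0)" using i [OF p3] by (simp add: times_quat_def)
  have p8: "P (Quat (-1/2) (-1/2) (-1/2) (-1/2))" using w [OF p3] by (simp add: times_quat_def)
  have p9: "P (Quat (-1/2) (-1/2) (1/2) (1/2))" using i [OF p4] by (simp add: times_quat_def)
  have p10: "P (Quat (-1/2) (-1/2) (1/2) (-1/2))" using w [OF p4] by (simp add: times_quat_def)
  have p11: "P (Quat (-1/2) (1/2) (-1/2) (-1/2))" using w [OF p5] by (simp add: times_quat_def)
  have p12: "P (Quat (-1/2) (-1/2) (-1/2) (1/2))" using i [OF p6] by (simp add: times_quat_def)
  have p13: "P (Quat (1/2) (-1/2) (-1/2) (1/2))" using w [OF p7] by (simp add: times_quat_def)
  have p14: "P (Quat (1/2) (-1/2) (1/2) (-1/2))" using i [OF p8] by (simp add: times_quat_def)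
  have p15: "P (Quat (1/2) (-1/2) (-1/2) (-1/2))" using w [OF p8] by (simp add: times_quat_def)
  have p16: "P (Quat (1/2) (-1/2) (1/2) (1/2))" using i [OF p10] by (simp add: times_quat_def)
  have p17: "P (Quat 0 0 0 (-1))" using w [OF p11] by (simp add: times_quat_def)
  have p18: "P (Quat 0 0 (-1) 0)" using w [OF p12] by (simp add: times_quat_def)
  have p19: "P (Quat (1/2) (1/2) (-1/2) (-1/2))" using i [OF p13] by (simp add: times_quat_def)
  have p20: "P (Quat (1/2) (1/2) (-1/2) (1/2))" using w [OF p13] by (simp add: times_quat_def)
  have p21: "P (Quat (1/2) (1/2) (1/2) (-1/2))" using i [OF p15] by (simp add: times_quat_def)
  have p22: "P (Quat 0 0 0 1)" using w [OF p16] by (simp add: times_quat_def)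
  have p23: "P (Quat 0 0 1 0)" using i [OF p17] by (simp add: times_quat_def)
  obtain a b c d where x: "x = Quat a b c d" by (cases x)
  show ?thesis
    using assms(1) [unfolded x]
  proof (cases rule: bin_tetrahedral_cases)
    case 1
    then show ?thesis
      unfolding quaternion_group x
      by (elim insertE emptyE) (simp_all only: p0 p1 p3 p7 p17 p18 p22 p23)
  next
    case 2
    then show ?thesis
      unfolding x
      by (elim conjE disjE)
        (simp_all only: p2 p4 p5 p6 p8 p9 p10 p11 p12 p13 p14 p15 p16 p19 p20 p21)
  qed
qed

lemma bin_tetrahedral_gens:
  assumes "x \<in> bin_tetrahedral"
  shows "Quat 0 1 0 0 * x \<in> bin_tetrahedral"
    and "Quat (1/2) (1/2) (1/2) (1/2) * x \<in> bin_tetrahedral"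
proof -
  obtain a b c d where x: "x = Quat a b c d" by (cases x)
  have m: "Quat 0 1 0 0 * x = Quat (- b) a (- d) c"
    "Quat (1/2) (1/2) (1/2) (1/2) * x = Quat ((a - b - c - d) / 2) ((a + b - c + d) / 2)
      ((a + b + c - d) / 2) ((a - b + c + d) / 2)"
    by (simp_all add: x times_quat_def field_simps)
  show "Quat 0 1 0 0 * x \<in> bin_tetrahedral"
    using assms [unfolded x]
  proof (cases rule: bin_tetrahedral_cases)
    case 1
    then show ?thesis unfolding m quaternion_group
      by (intro bin_tetrahedral_dihedralI) (auto simp: quaternion_group)
  next
    case 2
    then show ?thesis unfolding m by (intro bin_tetrahedral_halfI) auto
  qed
  show "Quat (1/2) (1/2) (1/2) (1/2) * x \<in> bin_tetrahedral"
    using assms [unfolded x]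
  proof (cases rule: bin_tetrahedral_cases)
    case 1
    then show ?thesis unfolding m quaternion_group
      by (intro bin_tetrahedral_halfI) auto
  next
    case 2
    have i: "Quat p q r s \<in> bin_tetrahedral"
      if "Quat p q r s \<in> bin_dihedral 2 \<or> \<bar>p\<bar> = 1/2 \<and> \<bar>q\<bar> = 1/2 \<and> \<bar>r\<bar> = 1/2 \<and> \<bar>s\<bar> = 1/2"
      for p q r s
      using that bin_tetrahedral_dihedralI bin_tetrahedral_halfI by blast
    show ?thesis
      using 2 unfolding m
      by (intro i) (elim conjE disjE; simp add: quaternion_group)
  qed
qed

lemma one_in_bin_tetrahedral: "1 \<in> bin_tetrahedral"
  by (simp add: bin_tetrahedral_def quaternion_group one_quat_def)

lemma bin_tetrahedral_mult:
  assumes "x \<in> bin_tetrahedral" "y \<in> bin_tetrahedral"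
  shows "x * y \<in> bin_tetrahedral"
  using assms(1)
  by (induction rule: bin_tetrahedral_induct) (simp_all add: assms(2) mult.assoc bin_tetrahedral_gens)

lemma bin_tetrahedral_unit: "x \<in> bin_tetrahedral \<Longrightarrow> qnorm_sq x = 1"
  by (induction rule: bin_tetrahedral_induct) (simp_all add: qnorm_sq_mult, simp_all add: qnorm_sq_def power2_eq_square)

lemma finite_bin_tetrahedral: "finite bin_tetrahedral"
proof -
  have "finite {Quat a b c d | a b c d. {a, b, c, d} \<subseteq> S}" if "finite S" for S :: "real set"
  proof (rule finite_subset)
    show "{Quat a b c d | a b c d. {a, b, c, d} \<subseteq> S}
        \<subseteq> (\<lambda>(a, b, c, d). Quat a b c d) ` (S \<times> S \<times> S \<times> S)" by force
  qed (use that in simp)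
  from this [of "{1/2, - 1/2}"] show ?thesis
    unfolding bin_tetrahedral_def quaternion_group by simp
qed

lemma subgroup_bin_tetrahedral: "subgroup bin_tetrahedral SU2"
  by (rule finite_mult_closed_subgroup)
    (simp_all add: finite_bin_tetrahedral one_in_bin_tetrahedral bin_tetrahedral_unit bin_tetrahedral_mult)

lemma expi_quarter: "expi (pi / 4) = Quat (sqrt 2 / 2) (sqrt 2 / 2) 0 0"
  by (simp add: expi_def cos_45 sin_45)

text \<open>Conjugation by \<open>e\<^sup>i\<^sup>\<pi>\<^sup>/\<^sup>4\<close> is a quarter turn in the plane of \<open>j\<close> and \<open>k\<close>, a symmetry of \<open>2T\<close>. Together with
\<open>(e\<^sup>i\<^sup>\<pi>\<^sup>/\<^sup>4)\<^sup>2 = i \<in> 2T\<close> this makes \<open>2T \<union> e\<^sup>i\<^sup>\<pi>\<^sup>/\<^sup>4 2T\<close> a group.\<close>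

lemma bin_tetrahedral_normalised:
  assumes "x \<in> bin_tetrahedral"
  shows "\<exists>y\<in>bin_tetrahedral. x * expi (pi / 4) = expi (pi / 4) * y"
proof -
  obtain a b c d where x: "x = Quat a b c d" by (cases x)
  have "Quat a b d (- c) \<in> bin_tetrahedral"
    using assms [unfolded x]
  proof (cases rule: bin_tetrahedral_cases)
    case 1
    then show ?thesis
      by (intro bin_tetrahedral_dihedralI) (auto simp: quaternion_group)
  next
    case 2
    then show ?thesis by (intro bin_tetrahedral_halfI) auto
  qed
  moreover have "x * expi (pi / 4) = expi (pi / 4) * Quat a b d (- c)"
    by (simp add: x expi_quarter times_quat_def algebra_simps)
  ultimately show ?thesis by blast
qed

lemma subgroup_bin_octahedral: "subgroup bin_octahedral SU2" "finite bin_octahedral"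
proof -
  let ?T = bin_tetrahedral and ?u = "expi (pi / 4)"
  show fin: "finite bin_octahedral"
    unfolding bin_octahedral_def by (simp add: finite_bin_tetrahedral)
  have sq: "?u * ?u * x \<in> ?T" if "x \<in> ?T" for x
  proof -
    have "?u * ?u = Quat 0 1 0 0" by (simp add: expi_quarter times_quat_def)
    then show ?thesis using bin_tetrahedral_gens(1) [OF that] by simp
  qed
  have "x * y \<in> bin_octahedral" if "x \<in> bin_octahedral" "y \<in> bin_octahedral" for x y
  proof -
    have e: "\<exists>s' \<in> ?T. s * (?u * t) = ?u * s'" if "s \<in> ?T" "t \<in> ?T" for s t
      using bin_tetrahedral_normalised [OF that(1)] bin_tetrahedral_mult that(2)
      by (metis mult.assoc)
    have "x \<in> ?T \<or> (\<exists>s\<in>?T. x = ?u * s)" "y \<in> ?T \<or> (\<exists>t\<in>?T. y = ?u * t)"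
      using that unfolding bin_octahedral_def by blast+
    then consider "x \<in> ?T" "y \<in> ?T" | t where "x \<in> ?T" "t \<in> ?T" "y = ?u * t"
      | s where "s \<in> ?T" "x = ?u * s" "y \<in> ?T"
      | s t where "s \<in> ?T" "x = ?u * s" "t \<in> ?T" "y = ?u * t"
      by blast
    then show ?thesis
    proof cases
      case 1 then show ?thesis by (simp add: bin_octahedral_def bin_tetrahedral_mult)
    next
      case 2 then show ?thesis using e unfolding bin_octahedral_def by blast
    next
      case 3 then show ?thesis by (auto simp: bin_octahedral_def mult.assoc bin_tetrahedral_mult)
    next
      case 4
      then obtain s' where "s' \<in> ?T" "x * y = ?u * (?u * s')" using e by (metis mult.assoc)
      then show ?thesis using sq by (simp add: bin_octahedral_def mult.assoc)
    qed
  qed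
  moreover have "1 \<in> bin_octahedral" by (simp add: bin_octahedral_def one_in_bin_tetrahedral)
  moreover have "qnorm_sq x = 1" if "x \<in> bin_octahedral" for x
    using that expi_carrier unfolding bin_octahedral_def
    by (auto simp: bin_tetrahedral_unit qnorm_sq_mult)
  ultimately show "subgroup bin_octahedral SU2"
    using finite_mult_closed_subgroup [OF fin] by blast
qed

lemma golden_sq: "golden * golden = golden + 1"
  by (simp add: golden_def field_simps)

lemma inverse_golden: "inverse golden = golden - 1"
proof -
  have "golden * (golden - 1) = 1" by (simp add: golden_sq right_diff_distrib)
  then show ?thesis by (metis inverse_unique)
qed

text \<open>In particular \<open>q\<close> has order 10, and \<open>q\<^sup>2\<close> has order 5.\<close>

lemma ico_q_powers:
  "ico_q ^ 0 = Quat 1 0 0 0"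
  "ico_q ^ 1 = Quat (golden / 2) ((golden - 1) / 2) (1 / 2) 0"
  "ico_q ^ 2 = Quat ((golden - 1) / 2) (1 / 2) (golden / 2) 0"
  "ico_q ^ 3 = Quat ((1 - golden) / 2) (1 / 2) (golden / 2) 0"
  "ico_q ^ 4 = Quat (- golden / 2) ((golden - 1) / 2) (1 / 2) 0"
  "ico_q ^ 5 = Quat (- 1) 0 0 0"
proof -
  show 0: "ico_q ^ 0 = Quat 1 0 0 0" by (simp add: one_quat_def)
  show 1: "ico_q ^ 1 = Quat (golden / 2) ((golden - 1) / 2) (1 / 2) 0"
    by (simp add: ico_q_def inverse_golden)
  have q: "ico_q ^ Suc k = Quat (golden / 2) ((golden - 1) / 2) (1 / 2) 0 * ico_q ^ k" for k
    using 1 by simp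
  show 2: "ico_q ^ 2 = Quat ((golden - 1) / 2) (1 / 2) (golden / 2) 0"
    using q [of 1] golden_sq unfolding 1 by (simp add: times_quat_def numeral_2_eq_2 field_simps)
  show 3: "ico_q ^ 3 = Quat ((1 - golden) / 2) (1 / 2) (golden / 2) 0"
    using q [of 2] golden_sq unfolding 2 by (simp add: times_quat_def numeral_3_eq_3 field_simps)
  have e: "(4::nat) = Suc 3" "(5::nat) = Suc 4" by simp_all
  show 4: "ico_q ^ 4 = Quat (- golden / 2) ((golden - 1) / 2) (1 / 2) 0"
    unfolding e(1) q 3 using golden_sq by (simp add: times_quat_def field_simps)
  show "ico_q ^ 5 = Quat (- 1) 0 0 0"
    unfolding e(2) q 4 using golden_sq by (simp add: times_quat_def field_simps)
qed

text \<open>Left multiplication by a generator \<open>i\<close> or \<open>\<omega>\<close> of \<open>2T\<close> permutes the five cosets \<open>q\<^sup>s 2T\<close> whose union is \<open>2I\<close>.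
The two tables below record this permutation together with the correcting factors in \<open>2T\<close>. As \<open>q\<close> itself
shifts the cosets cyclically, \<open>q\<^sup>5\<close> being \<open>-1\<close>, it follows that \<open>2I\<close> is closed under multiplication.\<close>

lemma ico_q_i:
  shows "Quat 0 1 0 0 * ico_q ^ 0 = ico_q ^ 0 * Quat 0 1 0 0"
    "Quat 0 1 0 0 * ico_q ^ 1 = ico_q ^ 3 * Quat (1/2) (-1/2) (1/2) (1/2)"
    "Quat 0 1 0 0 * ico_q ^ 2 = ico_q ^ 4 * Quat (1/2) (-1/2) (1/2) (-1/2)"
    "Quat 0 1 0 0 * ico_q ^ 3 = ico_q ^ 1 * Quat (-1/2) (-1/2) (1/2) (1/2)"
    "Quat 0 1 0 0 * ico_q ^ 4 = ico_q ^ 2 * Quat (-1/2) (-1/2) (1/2) (-1/2)"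
  unfolding ico_q_powers by (simp_all add: times_quat_def field_simps golden_sq)

lemma ico_q_w:
  shows "Quat (1/2) (1/2) (1/2) (1/2) * ico_q ^ 0 = ico_q ^ 0 * Quat (1/2) (1/2) (1/2) (1/2)"
    "Quat (1/2) (1/2) (1/2) (1/2) * ico_q ^ 1 = ico_q ^ 4 * Quat (1/2) (-1/2) (-1/2) (-1/2)"
    "Quat (1/2) (1/2) (1/2) (1/2) * ico_q ^ 2 = ico_q ^ 1 * Quat 0 0 1 0"
    "Quat (1/2) (1/2) (1/2) (1/2) * ico_q ^ 3 = ico_q ^ 3 * Quat (1/2) (1/2) (1/2) (-1/2)"
    "Quat (1/2) (1/2) (1/2) (1/2) * ico_q ^ 4 = ico_q ^ 2 * Quat (-1/2) (1/2) (1/2) (-1/2)"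
  unfolding ico_q_powers by (simp_all add: times_quat_def field_simps golden_sq)

lemma bin_icosahedral_iff:
  "x \<in> bin_icosahedral \<longleftrightarrow> (\<exists>s t. s \<le> 4 \<and> t \<in> bin_tetrahedral \<and> x = ico_q ^ s * t)"
  unfolding bin_icosahedral_def by auto

lemma bin_icosahedral_left_mult:
  assumes "\<And>s. s \<le> 4 \<Longrightarrow> \<exists>s' t. s' \<le> 4 \<and> t \<in> bin_tetrahedral \<and> y * ico_q ^ s = ico_q ^ s' * t"
    and "x \<in> bin_icosahedral"
  shows "y * x \<in> bin_icosahedral"
proof -
  obtain s t where x: "s \<le> 4" "t \<in> bin_tetrahedral" "x = ico_q ^ s * t"
    using assms(2) bin_icosahedral_iff by blast
  obtain s' t' where "s' \<le> 4" "t' \<in> bin_tetrahedral" "y * ico_q ^ s = ico_q ^ s' * t'"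
    using assms(1) x(1) by blast
  then have "y * x = ico_q ^ s' * (t' * t)" "t' * t \<in> bin_tetrahedral"
    using x by (simp_all add: bin_tetrahedral_mult flip: mult.assoc)
  then show ?thesis using bin_icosahedral_iff \<open>s' \<le> 4\<close> by blast
qed

lemma bin_icosahedral_gens:
  assumes "x \<in> bin_icosahedral"
  shows "Quat 0 1 0 0 * x \<in> bin_icosahedral"
    and "Quat (1/2) (1/2) (1/2) (1/2) * x \<in> bin_icosahedral"
    and "ico_q * x \<in> bin_icosahedral"
proof -
  have T: "Quat (-1) 0 0 0 \<in> bin_tetrahedral" "Quat 0 1 0 0 \<in> bin_tetrahedral" "Quat 0 0 1 0 \<in> bin_tetrahedral"
    by (simp_all add: bin_tetrahedral_dihedralI quaternion_group)
  have H: "Quat a b c d \<in> bin_tetrahedral" if "\<bar>a\<bar> = 1/2 \<and> \<bar>b\<bar> = 1/2 \<and> \<bar>c\<bar> = 1/2 \<and> \<bar>d\<bar> = 1/2" for a b c d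
    using that bin_tetrahedral_halfI by blast
  have W: "\<exists>s' t. s' \<le> 4 \<and> t \<in> bin_tetrahedral \<and> y = ico_q ^ s' * t"
    if "y = ico_q ^ s' * t" "s' \<le> 4" "t \<in> bin_tetrahedral" for y s' t
    using that by blast
  show "Quat 0 1 0 0 * x \<in> bin_icosahedral"
  proof (rule bin_icosahedral_left_mult [OF _ assms])
    fix s :: nat assume "s \<le> 4"
    then consider "s = 0" | "s = 1" | "s = 2" | "s = 3" | "s = 4" by linarith
    then show "\<exists>s' t. s' \<le> 4 \<and> t \<in> bin_tetrahedral \<and> Quat 0 1 0 0 * ico_q ^ s = ico_q ^ s' * t"
      by cases (simp_all only:, (rule W [OF ico_q_i(1)], simp, simp add: T), (rule W [OF ico_q_i(2)], simp, simp add: H), (rule W [OF ico_q_i(3)], simp, simp add: T H), (rule W [OF ico_q_i(4)], simp, simp add: H), (rule W [OF ico_q_i(5)], simp, simp add: H))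
  qed
  show "Quat (1/2) (1/2) (1/2) (1/2) * x \<in> bin_icosahedral"
  proof (rule bin_icosahedral_left_mult [OF _ assms])
    fix s :: nat assume "s \<le> 4"
    then consider "s = 0" | "s = 1" | "s = 2" | "s = 3" | "s = 4" by linarith
    then show "\<exists>s' t. s' \<le> 4 \<and> t \<in> bin_tetrahedral \<and> Quat (1/2) (1/2) (1/2) (1/2) * ico_q ^ s = ico_q ^ s' * t"
      by cases (simp_all only:, (rule W [OF ico_q_w(1)], simp, simp add: H), (rule W [OF ico_q_w(2)], simp, simp add: H), (rule W [OF ico_q_w(3)], simp, simp add: T H), (rule W [OF ico_q_w(4)], simp, simp add: H), (rule W [OF ico_q_w(5)], simp, simp add: H))
  qed
  show "ico_q * x \<in> bin_icosahedral"
  proof (rule bin_icosahedral_left_mult [OF _ assms])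
    fix s :: nat assume "s \<le> 4"
    show "\<exists>s' t. s' \<le> 4 \<and> t \<in> bin_tetrahedral \<and> ico_q * ico_q ^ s = ico_q ^ s' * t"
    proof (cases "s = 4")
      case True
      have "ico_q * ico_q ^ 4 = ico_q ^ 5" by (simp flip: power_Suc)
      also have "\<dots> = ico_q ^ 0 * Quat (-1) 0 0 0" unfolding ico_q_powers by (simp add: times_quat_def)
      finally show ?thesis unfolding True by (rule W) (simp_all add: T)
    next
      case False
      have "ico_q * ico_q ^ s = ico_q ^ Suc s * 1" by simp
      then show ?thesis by (rule W) (use False \<open>s \<le> 4\<close> one_in_bin_tetrahedral in auto)
    qed
  qed
qed

lemma bin_tetrahedral_subset_icosahedral: "bin_tetrahedral \<subseteq> bin_icosahedral"
proof
  fix x assume "x \<in> bin_tetrahedral"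
  moreover have "x = ico_q ^ 0 * x" by simp
  ultimately show "x \<in> bin_icosahedral" unfolding bin_icosahedral_iff by blast
qed

lemma subgroup_bin_icosahedral: "subgroup bin_icosahedral SU2" "finite bin_icosahedral"
proof -
  show fin: "finite bin_icosahedral"
    unfolding bin_icosahedral_def by (simp add: finite_bin_tetrahedral)
  have T: "t * y \<in> bin_icosahedral" if "t \<in> bin_tetrahedral" "y \<in> bin_icosahedral" for t y
    using that(1)
    by (induction rule: bin_tetrahedral_induct) (simp_all add: that(2) mult.assoc bin_icosahedral_gens)
  have Q: "ico_q ^ s * y \<in> bin_icosahedral" if "y \<in> bin_icosahedral" for s y
    by (induction s) (simp_all add: that mult.assoc bin_icosahedral_gens)
  have "x * y \<in> bin_icosahedral" if "x \<in> bin_icosahedral" "y \<in> bin_icosahedral" for x y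
    using that T Q unfolding bin_icosahedral_iff [of x] by (auto simp: mult.assoc)
  moreover have "1 \<in> bin_icosahedral"
    using bin_tetrahedral_subset_icosahedral one_in_bin_tetrahedral by blast
  moreover have "qnorm_sq (ico_q ^ s) = 1" for s
  proof (induction s)
    case (Suc s)
    have "qnorm_sq ico_q = 1"
    proof -
      have "golden\<^sup>2 + (golden - 1)\<^sup>2 + 1 = 4"
        by (simp add: power2_eq_square algebra_simps golden_sq)
      then show ?thesis by (simp add: ico_q_def inverse_golden qnorm_sq_def power_divide)
    qed
    then show ?case using Suc by (simp add: qnorm_sq_mult)
  qed simp
  then have "qnorm_sq x = 1" if "x \<in> bin_icosahedral" for x
    using that unfolding bin_icosahedral_iff by (auto simp: qnorm_sq_mult bin_tetrahedral_unit)
  ultimately show "subgroup bin_icosahedral SU2"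
    using finite_mult_closed_subgroup [OF fin] by blast
qed

section \<open>ADE groups\<close>

lemma minus_one_in_bin_tetrahedral: "minus_one \<in> bin_tetrahedral"
  by (simp add: bin_tetrahedral_dihedralI quaternion_group minus_one_def)

lemma minus_one_in_bin_dihedral: "n > 0 \<Longrightarrow> minus_one \<in> bin_dihedral n"
  unfolding bin_dihedral_zeta using zeta_half by (metis UnI1 rangeI)

lemma zeta_in_range:
  assumes "d dvd n" "n > 0"
  shows "zeta d x \<in> range (zeta n)"
proof -
  obtain e where "n = d * e" using assms by blast
  then show ?thesis using zeta_scale [of e d x] assms by (metis nat_0_less_mult_iff rangeI)
qed

lemma zeta_2: "zeta 2 1 = minus_one"
  by (simp add: zeta_def expi_def minus_one_def)

text \<open>All ADE groups of even order contain \<open>-1\<close>, and the only ones of odd order are cyclic.\<close>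

lemma ADE_minus_one:
  assumes "ADE B" "minus_one \<notin> B"
  shows "\<exists>m\<ge>2. odd m \<and> B = cyc m"
proof -
  have "minus_one \<in> cyc m" if "even m" "m \<ge> 2" for m
    using zeta_in_range [of 2 m 1] that unfolding zeta_2 cyc_zeta by simp
  moreover have "minus_one \<in> bin_dihedral m" if "m \<ge> 2" for m
    using that by (intro minus_one_in_bin_dihedral) simp
  moreover have "minus_one \<in> bin_octahedral"
    using minus_one_in_bin_tetrahedral by (simp add: bin_octahedral_def)
  moreover have "minus_one \<in> bin_icosahedral"
    using minus_one_in_bin_tetrahedral bin_tetrahedral_subset_icosahedral by blast
  ultimately show ?thesis
    using assms minus_one_in_bin_tetrahedral unfolding ADE_def by blast
qed

lemma ADE_subgroup:
  assumes "ADE A"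
  shows "subgroup A SU2" "finite A" "A \<noteq> {1}"
proof -
  show "subgroup A SU2" "finite A"
    using assms subgroup_cyc subgroup_bin_dihedral subgroup_bin_tetrahedral finite_bin_tetrahedral
      subgroup_bin_octahedral subgroup_bin_icosahedral
    unfolding ADE_def by auto
  show "A \<noteq> {1}"
  proof (cases "minus_one \<in> A")
    case True
    then show ?thesis using minus_one_simps(3) by auto
  next
    case False
    then obtain m where m: "m \<ge> 2" "A = cyc m" using ADE_minus_one [OF assms] by blast
    have "zeta m 1 \<noteq> zeta m 0" using m(1) by (simp add: zeta_eq_iff cong_def del: zeta_0)
    then show ?thesis unfolding m(2) cyc_zeta by auto
  qed
qed

section \<open>Real parts of elements of small order\<close>

lemma cos_2pi_3: "cos (2 * pi / 3) = - 1 / 2"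
proof -
  have "cos (2 * pi / 3) = - cos (pi / 3)"
    using cos_minus_pi [of "pi / 3"] by (simp add: cos_diff)
  then show ?thesis by (simp add: cos_60)
qed

text \<open>Put \<open>\<theta> = 2\<pi>/5\<close>. From \<open>3\<theta> = 2\<pi> - 2\<theta>\<close> one gets \<open>cos 3\<theta> = cos 2\<theta>\<close>, a cubic equation for \<open>cos \<theta>\<close> with
the extraneous root 1; the remaining quadratic has \<open>(\<phi> - 1)/2\<close> as its only positive root, where \<open>\<phi>\<close> is the
golden ratio.\<close>

lemma cos_2pi_5: "cos (2 * pi / 5) = (golden - 1) / 2"
proof -
  define c where "c = cos (2 * pi / 5)"
  have "cos (3 * (2 * pi / 5)) = cos (2 * pi - 2 * (2 * pi / 5))" by simp
  also have "\<dots> = cos (2 * (2 * pi / 5))" by (simp only: cos_2pi_minus)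
  finally have "4 * c ^ 3 - 3 * c = 2 * c\<^sup>2 - 1"
    unfolding cos_treble_cos cos_double_cos c_def .
  then have "(c - 1) * (4 * c\<^sup>2 + 2 * c - 1) = 0"
    by (simp add: power2_eq_square power3_eq_cube algebra_simps)
  moreover have "c < 1" using cos_monotone_0_pi [of 0 "2 * pi / 5"] by (simp add: c_def)
  ultimately have "4 * c\<^sup>2 + 2 * c - 1 = 0" by simp
  moreover define e where "e = (golden - 1) / 2"
  have "4 * e\<^sup>2 = (golden - 1)\<^sup>2" "2 * e = golden - 1" by (simp_all add: e_def power_divide)
  then have "4 * e\<^sup>2 + 2 * e - 1 = 0"
    using golden_sq by (simp add: power2_eq_square algebra_simps)
  ultimately have "(c - e) * (2 * c + 2 * e + 1) = 0"
    by (simp add: power2_eq_square algebra_simps)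
  moreover have "c > 0" unfolding c_def by (rule cos_gt_zero_pi) (auto simp: field_simps)
  moreover have "e > 0" by (simp add: e_def golden_def)
  then have "2 * c + 2 * e + 1 > 0" using \<open>c > 0\<close> by linarith
  ultimately have "c = e" by simp
  then show ?thesis unfolding c_def e_def .
qed

lemma zeta_3_5:
  "qre (zeta 3 1) = - 1 / 2" "qre (zeta 5 1) = (golden - 1) / 2"
  by (simp_all add: zeta_def expi_def cos_2pi_3 cos_2pi_5)

lemma qre_zeta_pm:
  assumes "n > 0" "[a = 1] (mod int n) \<or> [a = - 1] (mod int n)"
  shows "qre (zeta n (a * x)) = qre (zeta n x)"
  using assms(2)
proof
  assume "[a = 1] (mod int n)"
  then have "[a * x = 1 * x] (mod int n)" by (rule cong_scalar_right)
  then show ?thesis using zeta_eq_iff [OF assms(1)] by (metis mult_1)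
next
  assume "[a = - 1] (mod int n)"
  then have "[a * x = - 1 * x] (mod int n)" by (rule cong_scalar_right)
  then have "zeta n (a * x) = zeta n (- x)" using zeta_eq_iff [OF assms(1)] by simp
  then show ?thesis by simp
qed

section \<open>Rotations fixed up to inversion\<close>

lemma automorphism_zeta:
  assumes "subgroup A SU2" "\<phi> \<in> automorphisms A" "range (zeta n) \<subseteq> A" "n > 0"
    and "\<phi> (zeta n 1) = zeta n a"
  shows "\<phi> (zeta n x) = zeta n (a * x)"
proof -
  have nat: "\<phi> (zeta n (int k)) = zeta n (a * int k)" for k
  proof (induction k)
    case 0
    then show ?case using automorphism_one [OF assms(1,2)] by simp
  next
    case (Suc k)
    have "zeta n (int (Suc k)) = zeta n 1 * zeta n (int k)" by (simp flip: zeta_add)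
    then have "\<phi> (zeta n (int (Suc k))) = zeta n a * zeta n (a * int k)"
      using automorphism_mult [OF assms(2), of "zeta n 1" "zeta n (int k)"] assms(3,5) Suc by auto
    then show ?case by (simp add: algebra_simps flip: zeta_add)
  qed
  define k where "k = nat (x mod int n)"
  have k: "[int k = x] (mod int n)" using assms(4) by (simp add: k_def cong_def)
  then have "zeta n x = zeta n (int k)" "zeta n (a * x) = zeta n (a * int k)"
    using zeta_eq_iff [OF assms(4)] by (metis cong_sym cong_scalar_left)+
  then show ?thesis using nat by simp
qed

text \<open>If \<open>d\<close> divides \<open>gcd (1 + a) n\<close> or \<open>gcd (1 - a) n\<close>, then \<open>\<phi>\<close> inverts or fixes the primitive \<open>d\<close>-th root of unity
in \<open>A\<close>, and so preserves its real part. In a free action this real part cannot occur in \<open>B\<close>.\<close>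

lemma free_no_fixed_root:
  assumes "subgroup A SU2" "subgroup B SU2" "\<phi> \<in> automorphisms A"
    and "acts_freely (type_I \<phi> A B)"
    and "range (zeta n) \<subseteq> A" "n > 0" "\<And>x. \<phi> (zeta n x) = zeta n (a * x)"
    and k: "k \<in> {gcd (1 + a) (int n), gcd (1 - a) (int n)}"
    and "d > 1" "int d dvd k" "b \<in> B"
  shows "qre b \<noteq> qre (zeta d 1)"
proof
  assume b: "qre b = qre (zeta d 1)"
  have dn: "d dvd n" using k assms(10) by auto
  have "int d dvd 1 + a \<or> int d dvd 1 - a" using k assms(10) by auto
  then have "int d dvd a - 1 \<or> int d dvd a - (- 1)"
    by (metis add.commute diff_minus_eq_add dvd_minus_iff minus_diff_eq)
  then have pm: "[a = 1] (mod int d) \<or> [a = - 1] (mod int d)" by (simp only: cong_iff_dvd_diff)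
  obtain c where c: "n = d * c" using dn by blast
  then have "c > 0" using assms(6) by simp
  then have z: "zeta d x = zeta n (x * int c)" for x using zeta_scale c by metis
  have "\<phi> (zeta d 1) = zeta d (a * 1)" unfolding z using assms(7) by simp
  then have "qre (\<phi> (zeta d 1)) = qre b" using qre_zeta_pm [OF _ pm, of 1] assms(9) b by simp
  moreover have "zeta d 1 \<in> A" using z assms(5) by auto
  ultimately have "b = 1" using free_type_I_no_common_re [OF assms(1-4)] assms(11) b by metis
  then have "zeta d 1 = zeta d 0" using b unit_eq_one_iff [of "zeta d 1"] by simp
  then have "[1 = 0] (mod int d)" using assms(9) by (simp add: zeta_eq_iff del: zeta_0)
  then show False using assms(9) by (simp add: cong_0_iff)
qed

text \<open>If \<open>\<phi>\<close> preserved real parts, an element of \<open>A\<close> that shares its real part with a non-trivial \<open>b \<in> B\<close> would give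
an element of \<open>\<Gamma>(\<phi>, A) \<times> B\<close> with a fixed point.\<close>

lemma not_re_preserving:
  assumes "ADE A" "ADE B" "\<phi> \<in> automorphisms A" "acts_freely (type_I \<phi> A B)"
    and "\<not> (\<exists>H. splittable H \<and> acts_freely H \<and> type_I \<phi> A B \<subseteq> H)"
  shows "\<exists>x\<in>A. qre (\<phi> x) \<noteq> qre x"
proof (rule ccontr)
  assume "\<not> ?thesis"
  then show False
    using common_re_if_not_in_free_splittable [OF ADE_subgroup [OF assms(1)] ADE_subgroup [OF assms(2)] assms(3,5)]
      free_type_I_no_common_re [OF ADE_subgroup(1) [OF assms(1)] ADE_subgroup(1) [OF assms(2)] assms(3,4)]
    by metis
qed

lemma minus_one_not_shared:
  assumes "subgroup A SU2" "subgroup B SU2" "\<phi> \<in> automorphisms A" "acts_freely (type_I \<phi> A B)"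
    and "minus_one \<in> A"
  shows "minus_one \<notin> B"
  using free_type_I_no_common_re [OF assms(1-4), of minus_one minus_one] assms(5)
    automorphism_minus_one [OF assms(1,3,5)] by auto

section \<open>Polyhedral first factors\<close>

lemma quaternion_group_re: "x \<in> bin_dihedral 2 \<Longrightarrow> qre x \<in> {1, - 1, 0}"
  by (auto simp: quaternion_group)

lemma bin_tetrahedral_re:
  assumes "x \<in> bin_tetrahedral"
  shows "qre x \<in> {1, - 1, 0, 1/2, - 1/2}"
proof -
  obtain a b c d where x: "x = Quat a b c d" by (cases x)
  show ?thesis
    using assms [unfolded x]
    by (cases rule: bin_tetrahedral_cases) (auto simp: x dest: quaternion_group_re)
qed

lemma bin_octahedral_re:
  assumes "x \<in> bin_octahedral"
  shows "qre x \<in> {1, - 1, 0, 1/2, - 1/2} \<or> (qre x)\<^sup>2 = 1/2"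
proof (cases "x \<in> bin_tetrahedral")
  case True
  then show ?thesis using bin_tetrahedral_re by blast
next
  case False
  then obtain t where t: "t \<in> bin_tetrahedral" "x = expi (pi / 4) * t"
    using assms unfolding bin_octahedral_def by blast
  obtain a b c d where abcd: "t = Quat a b c d" by (cases t)
  have re: "qre x = sqrt 2 / 2 * (a - b)"
    by (simp add: t(2) abcd expi_quarter times_quat_def algebra_simps)
  have "a - b \<in> {1, - 1, 0}"
    using t(1) [unfolded abcd]
    by (cases rule: bin_tetrahedral_cases) (auto simp: quaternion_group)
  moreover have "(qre x)\<^sup>2 = (a - b)\<^sup>2 / 2"
    unfolding re by (simp add: power_mult_distrib power_divide)
  ultimately show ?thesis by auto
qed

text \<open>A real part listed here belongs to an element of order 1, 2, 3, 4, 6 or 8. For the even orders some power of \<open>b\<close>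
would be \<open>-1\<close>, which is not in \<open>B\<close> because \<open>\<phi>\<close> fixes \<open>-1 \<in> A\<close>. For order 3 the real part of \<open>x\<close> is
preserved by \<open>\<phi>\<close>, so freeness excludes it.\<close>

lemma small_orders_excluded:
  assumes "subgroup A SU2" "subgroup B SU2" "\<phi> \<in> automorphisms A" "acts_freely (type_I \<phi> A B)"
    and "minus_one \<in> A"
    and "x \<in> A" "b \<in> B" "qre x = qre b"
    and "qre x \<in> {1, - 1, 0, 1/2, - 1/2} \<or> (qre x)\<^sup>2 = 1/2"
  shows "b = 1"
proof -
  have m: "minus_one \<notin> B" by (rule minus_one_not_shared [OF assms(1-5)])
  have u: "qnorm_sq b = 1" using assms(2,7) subgroup_unit by blast
  have re_m: "qre y \<noteq> - 1" if "y \<in> B" for y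
    using that m unit_eq_minus_one subgroup_unit [OF assms(2)] by metis
  have bb: "b * b \<in> B" "b * b * b \<in> B" using subgroup_mult assms(2,7) by blast+
  have re_0: "qre y \<noteq> 0" if "y \<in> B" for y
    using that re_m [OF subgroup_mult [OF assms(2) that that]] unit_square [of y]
      subgroup_unit [OF assms(2) that] by auto
  have "qre b \<noteq> 1/2"
  proof
    assume half: "qre b = 1/2"
    have "qre (b * b * b) = - 1" unfolding qre_cube [OF u] half by (simp add: power3_eq_cube)
    then show False using re_m [OF bb(2)] by simp
  qed
  moreover have "(qre b)\<^sup>2 \<noteq> 1/2" using re_0 [OF bb(1)] unit_square [OF u] by auto
  ultimately consider "qre b = 1" | "qre b = - 1/2"
    using assms(8,9) re_m [OF assms(7)] re_0 [OF assms(7)] by auto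
  then show ?thesis
  proof cases
    case 1
    then show ?thesis using u unit_eq_one_iff by blast
  next
    case 2
    then have "qre (\<phi> x) = qre b"
      using automorphism_re_order_three [OF assms(1,3,6)] assms(8) by simp
    then show ?thesis using free_type_I_no_common_re [OF assms(1-4,6,7)] assms(8) by blast
  qed
qed

lemma small_orders_in_splittable:
  assumes "ADE A" "ADE B" "\<phi> \<in> automorphisms A" "acts_freely (type_I \<phi> A B)"
    and "A = bin_dihedral 2 \<or> A = bin_tetrahedral \<or> A = bin_octahedral"
  shows "\<exists>H. splittable H \<and> acts_freely H \<and> type_I \<phi> A B \<subseteq> H"
proof (rule ccontr)
  assume "\<not> ?thesis"
  then obtain x b where xb: "x \<in> A" "b \<in> B" "qre x = qre b" "b \<noteq> 1"
    using common_re_if_not_in_free_splittable [OF ADE_subgroup [OF assms(1)] ADE_subgroup [OF assms(2)] assms(3)]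
    by metis
  have "qre x \<in> {1, - 1, 0, 1/2, - 1/2} \<or> (qre x)\<^sup>2 = 1/2"
    using assms(5) xb(1) quaternion_group_re bin_tetrahedral_re bin_octahedral_re by blast
  moreover have "minus_one \<in> A"
    using assms(5) minus_one_in_bin_dihedral [of 2] minus_one_in_bin_tetrahedral
    by (auto simp: bin_octahedral_def)
  ultimately show False
    using small_orders_excluded [OF ADE_subgroup(1) [OF assms(1)] ADE_subgroup(1) [OF assms(2)] assms(3,4)] xb
    by blast
qed

text \<open>The group \<open>2I\<close> contains \<open>-1\<close> and elements of order 3, whose real parts every automorphism
preserves, so a free action keeps such elements out of \<open>B\<close>.\<close>

lemma type_I_icosahedral:
  assumes "ADE B" "\<phi> \<in> automorphisms bin_icosahedral" "acts_freely (type_I \<phi> bin_icosahedral B)"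
  shows "\<exists>m\<ge>2. \<not> 3 dvd m \<and> B = cyc m"
proof -
  note free = subgroup_bin_icosahedral(1) ADE_subgroup(1) [OF assms(1)] assms(2,3)
  have "minus_one \<notin> B"
    using minus_one_not_shared [OF free] minus_one_in_bin_tetrahedral bin_tetrahedral_subset_icosahedral
    by blast
  then obtain m where m: "m \<ge> 2" "B = cyc m" using ADE_minus_one [OF assms(1)] by blast
  have "\<not> 3 dvd m"
  proof
    assume "3 dvd m"
    then have "zeta 3 1 \<in> B" using zeta_in_range m unfolding cyc_zeta by simp
    moreover have "Quat (-1/2) (1/2) (1/2) (1/2) \<in> bin_icosahedral" (is "?w \<in> _")
      using bin_tetrahedral_halfI bin_tetrahedral_subset_icosahedral by auto
    moreover have "qre (\<phi> ?w) = - 1/2"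
      by (rule automorphism_re_order_three [OF free(1,3)]) (use calculation in simp_all)
    ultimately have "zeta 3 1 = 1" 
      using free_type_I_no_common_re [OF free, of ?w "zeta 3 1"] by (simp add: zeta_3_5)
    then show False using zeta_3_5(1) by simp
  qed
  then show ?thesis using m by blast
qed

section \<open>Cyclic and binary dihedral first factors\<close>

lemma power_aut_zeta: "power_aut r (zeta n x) = zeta n (r * x)"
  by (simp add: power_aut_def zeta_def expi_int_pow ac_simps)

lemma automorphism_cyc:
  assumes "n > 0" "\<phi> \<in> automorphisms (cyc n)"
  obtains r where "coprime r (int n)" "\<And>x. \<phi> (zeta n x) = zeta n (r * x)"
proof -
  have "\<phi> (zeta n 1) \<in> cyc n" using automorphism_image [OF assms(2)] cyc_zeta by blast
  then obtain r where "\<phi> (zeta n 1) = zeta n r" unfolding cyc_zeta by blast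
  then have r: "\<phi> (zeta n x) = zeta n (r * x)" for x
    using automorphism_zeta [OF subgroup_cyc(1) [OF assms(1)] assms(2)] assms(1) cyc_zeta by blast
  have "zeta n 1 \<in> \<phi> ` cyc n" using automorphism_image [OF assms(2)] cyc_zeta by blast
  then obtain x where "zeta n 1 = zeta n (r * x)" unfolding cyc_zeta using r by auto
  then have "[r * x = 1] (mod int n)" using zeta_eq_iff [OF assms(1)] cong_sym by metis
  then have "coprime r (int n)" using coprime_iff_invertible_int by blast
  then show thesis using that r by blast
qed

text \<open>The coprimality conditions: a common divisor \<open>d > 1\<close> would put the \<open>d\<close>-th roots of unity into \<open>B\<close>. For binary
dihedral \<open>B\<close> this applies to its subgroup of rotations.\<close>

lemma free_cyclic_factor_coprime:
  assumes "subgroup A SU2" "subgroup B SU2" "\<phi> \<in> automorphisms A"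
    and "acts_freely (type_I \<phi> A B)"
    and "range (zeta n) \<subseteq> A" "n > 0" "\<And>x. \<phi> (zeta n x) = zeta n (a * x)"
    and k: "k \<in> {gcd (1 + a) (int n), gcd (1 - a) (int n)}"
    and "range (zeta m) \<subseteq> B" "m > 0"
  shows "gcd (int m) k = 1"
proof (rule ccontr)
  assume ne: "gcd (int m) k \<noteq> 1"
  define d where "d = nat (gcd (int m) k)"
  have d: "int d = gcd (int m) k" by (simp add: d_def)
  moreover have "gcd (int m) k > 0" using assms(10) by (simp add: gcd_pos_int)
  ultimately have "d > 1" using ne by linarith
  moreover have "int d dvd k" "d dvd m" unfolding d by (simp, metis d gcd_dvd1 int_dvd_int_iff)
  moreover have "zeta d 1 \<in> B" using zeta_in_range [OF \<open>d dvd m\<close> assms(10)] assms(9) by blast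
  ultimately show False using free_no_fixed_root [OF assms(1-8)] by blast
qed

lemma zeta_neq_unit_j_zeta: "zeta n x \<noteq> unit_j * zeta n y"
proof
  assume e: "zeta n x = unit_j * zeta n y"
  have "qj (zeta n x) = 0" "qk (zeta n x) = 0" by (simp_all add: zeta_def expi_def)
  moreover have "qre (zeta n x) = 0" "qi (zeta n x) = 0"
    unfolding e by (simp_all add: zeta_def expi_def unit_j_def times_quat_def)
  ultimately show False using zeta_unit [of n x] by (simp add: qnorm_sq_def)
qed

lemma dih_t_pow: "dih_t n [^]\<^bsub>SU2\<^esub> (p :: int) = zeta (2 * n) p"
  by (simp add: dih_t_def expi_int_pow zeta_def mult.commute)

lemma dih_s_zeta: "dih_s n = unit_j * zeta (2 * n) 1"
  by (simp add: dih_s_def zeta_def)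

text \<open>All elements of \<open>2D\<^sub>2\<^sub>n\<close> outside the rotation subgroup have order 4, while the generating rotation has order
\<open>2n > 4\<close>. Hence \<open>\<phi>\<close> maps rotations to rotations, and by surjectivity it maps \<open>j\<close> to a non-rotation.\<close>

lemma automorphism_bin_dihedral:
  assumes "n > 2" "\<phi> \<in> automorphisms (bin_dihedral n)"
  obtains a b where "coprime a (2 * int n)" "\<And>x. \<phi> (zeta (2 * n) x) = zeta (2 * n) (a * x)"
    "\<And>x. \<phi> (unit_j * zeta (2 * n) x) = unit_j * zeta (2 * n) (a * x + b)"
proof -
  let ?z = "zeta (2 * n)" and ?A = "bin_dihedral n"
  have n: "n > 0" "2 * n > 0" using assms(1) by simp_all
  have zA: "?z x \<in> ?A" and jA: "unit_j * ?z x \<in> ?A" for x by (auto simp: bin_dihedral_zeta)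
  have j: "unit_j \<in> ?A" using jA [of 0] by simp
  note sg = subgroup_bin_dihedral(1) [OF n(1)]
  have \<phi>A: "\<phi> x \<in> ?A" if "x \<in> ?A" for x using automorphism_image [OF assms(2)] that by blast
  have "\<phi> (?z 1) \<in> range ?z"
  proof (rule ccontr)
    assume "\<phi> (?z 1) \<notin> range ?z"
    then obtain c where c: "\<phi> (?z 1) = unit_j * ?z c"
      using \<phi>A [OF zA [of 1]] unfolding bin_dihedral_zeta by blast
    have "\<phi> (?z 2) = \<phi> (?z 1) * \<phi> (?z 1)"
      using automorphism_mult [OF assms(2) zA zA, of 1 1] by (simp flip: zeta_add)
    also have "\<dots> = minus_one"
      unfolding c by (rule unit_eq_minus_one) (simp_all add: unit_square qnorm_sq_mult)
    finally have "\<phi> (?z 4) = 1"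
      using automorphism_mult [OF assms(2) zA zA, of 2 2] by (simp flip: zeta_add)
    then have "?z 4 = ?z 0" using automorphism_eq_one_iff [OF sg assms(2) zA] by simp
    then have "[4 = 0] (mod int (2 * n))" using zeta_eq_iff [OF n(2)] by blast
    then have "int (2 * n) \<le> 4" unfolding cong_0_iff by (rule zdvd_imp_le) simp
    then show False using assms(1) by simp
  qed
  then obtain a where "\<phi> (?z 1) = ?z a" by blast
  then have a: "\<phi> (?z x) = ?z (a * x)" for x
    using automorphism_zeta [OF sg assms(2) _ n(2)] zA by blast
  have "\<phi> unit_j \<notin> range ?z"
  proof
    assume "\<phi> unit_j \<in> range ?z"
    then obtain c where c: "\<phi> unit_j = ?z c" by blast
    have "\<phi> ` ?A \<subseteq> range ?z"
    proof
      fix y assume "y \<in> \<phi> ` ?A"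
      then obtain x where "y = \<phi> (?z x) \<or> y = \<phi> (unit_j * ?z x)" unfolding bin_dihedral_zeta by blast
      then have "y = ?z (a * x) \<or> y = ?z (c + a * x)"
        using a c automorphism_mult [OF assms(2) j zA] by (simp add: zeta_add)
      then show "y \<in> range ?z" by blast
    qed
    then have "unit_j * ?z 0 \<in> range ?z" using automorphism_image [OF assms(2)] jA by blast
    then show False using zeta_neq_unit_j_zeta by (metis imageE)
  qed
  then obtain b where b: "\<phi> unit_j = unit_j * ?z b"
    using \<phi>A [OF j] unfolding bin_dihedral_zeta by blast
  have jz: "\<phi> (unit_j * ?z x) = unit_j * ?z (a * x + b)" for x
    using automorphism_mult [OF assms(2) j zA] a b by (simp add: add.commute [of "a * x"] zeta_add mult.assoc)
  have "?z 1 \<in> \<phi> ` ?A" using automorphism_image [OF assms(2)] zA by blast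
  then obtain x where "?z 1 = \<phi> (?z x) \<or> ?z 1 = \<phi> (unit_j * ?z x)" unfolding bin_dihedral_zeta by blast
  then have "?z (a * x) = ?z 1" using a jz zeta_neq_unit_j_zeta by metis
  then have "[a * x = 1] (mod int (2 * n))" using zeta_eq_iff [OF n(2)] by blast
  then have "coprime a (int (2 * n))" using coprime_iff_invertible_int by blast
  then show thesis using that a jz by simp
qed

text \<open>Since \<open>j \<cdot> (rotation)\<close> always has real part 0, only the action of \<open>\<phi>\<close> on rotations matters for real parts. The
second factor is cyclic of odd order because \<open>-1 \<in> A\<close>.\<close>

lemma type_I_dihedral:
  assumes "n > 2" "A = bin_dihedral n" "ADE B" "\<phi> \<in> automorphisms A" "acts_freely (type_I \<phi> A B)"
    and "\<not> (\<exists>H. splittable H \<and> acts_freely H \<and> type_I \<phi> A B \<subseteq> H)"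
  shows "\<exists>m a b. m \<ge> 2 \<and> coprime a (2 * int n) \<and>
       \<not> [a = 1] (mod (2 * int n)) \<and> \<not> [a = - 1] (mod (2 * int n)) \<and> \<not> 4 dvd m \<and>
       (\<forall>k\<in>{gcd (1 + a) (2 * int n), gcd (1 - a) (2 * int n)}. k > 1 \<longrightarrow> gcd k (int m) = 1) \<and>
       type_I \<phi> A B = type_I (tau n a b) (bin_dihedral n) (cyc m)"
proof -
  let ?z = "zeta (2 * n)"
  have n: "n > 0" "2 * n > 0" using assms(1) by simp_all
  have "n \<ge> 2" using assms(1) by simp
  then have "ADE A" using assms(2) unfolding ADE_def by blast
  note free = ADE_subgroup(1) [OF \<open>ADE A\<close>] ADE_subgroup(1) [OF assms(3)] assms(4,5)
  have zA: "range ?z \<subseteq> A" by (simp add: assms(2) bin_dihedral_zeta)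
  obtain a b where co: "coprime a (2 * int n)" and z: "\<And>x. \<phi> (?z x) = ?z (a * x)"
    and jz: "\<And>x. \<phi> (unit_j * ?z x) = unit_j * ?z (a * x + b)"
    using automorphism_bin_dihedral [OF assms(1)] assms(2,4) by blast
  have pm: "\<not> ([a = 1] (mod int (2 * n)) \<or> [a = - 1] (mod int (2 * n)))"
  proof
    assume "[a = 1] (mod int (2 * n)) \<or> [a = - 1] (mod int (2 * n))"
    then have "qre (?z (a * x)) = qre (?z x)" for x by (rule qre_zeta_pm [OF n(2)])
    then have "qre (\<phi> x) = qre x" if "x \<in> A" for x
      using that unfolding assms(2) bin_dihedral_zeta by (auto simp: z jz)
    then show False using not_re_preserving [OF \<open>ADE A\<close> assms(3-6)] by blast
  qed
  have "minus_one \<notin> B"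
    using minus_one_not_shared [OF free] minus_one_in_bin_dihedral n assms(2) by blast
  then obtain m where m: "m \<ge> 2" "odd m" "B = cyc m" using ADE_minus_one [OF assms(3)] by blast
  have m4: "\<not> 4 dvd m" using m(2) by (meson dvd_trans even_numeral)
  have co_k: "gcd k (int m) = 1"
    if "k \<in> {gcd (1 + a) (2 * int n), gcd (1 - a) (2 * int n)}" for k
    using free_cyclic_factor_coprime [OF free zA n(2) z, of k m] that m
    by (simp add: cyc_zeta gcd.commute)
  \<comment> \<open>The shift by \<open>a - 1\<close> arises because \<open>\<tau>\<^sub>a\<^sub>,\<^sub>b\<close> is described by its effect on \<open>s = j t\<close>, not on \<open>j\<close>.\<close>
  have tau: "type_I \<phi> A B = type_I (tau n a (b + a - 1)) (bin_dihedral n) (cyc m)"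
  proof -
    have t: "tau n a c (?z p) = ?z (a * p)" for c p
      using tau_t [of n a c p] by (simp only: dih_t_pow)
    have st: "tau n a c (unit_j * ?z (p + 1)) = unit_j * ?z (a * p + c + 1)" for c p
      using tau_st [of n a c p] by (simp add: dih_t_pow dih_s_zeta mult.assoc add.commute flip: zeta_add)
    have "\<phi> x = tau n a (b + a - 1) x" if "x \<in> A" for x
    proof -
      have "tau n a (b + a - 1) (unit_j * ?z p) = unit_j * ?z (a * p + b)" for p
        using st [of "b + a - 1" "p - 1"] by (simp add: algebra_simps)
      then show ?thesis using that t z jz unfolding assms(2) bin_dihedral_zeta by auto
    qed
    then show ?thesis unfolding assms(2) [symmetric] m(3) [symmetric] by (rule type_I_cong)
  qed
  have pm': "\<not> [a = 1] (mod 2 * int n)" "\<not> [a = - 1] (mod 2 * int n)" using pm by simp_all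
  show ?thesis
    by (intro exI [of _ m] exI [of _ a] exI [of _ "b + a - 1"] conjI ballI impI m(1) co pm' m4 tau)
      (rule co_k)
qed

lemma type_I_cyclic:
  assumes "n \<ge> 2" "A = cyc n" "ADE B" "\<phi> \<in> automorphisms A" "acts_freely (type_I \<phi> A B)"
    and "\<not> (\<exists>H. splittable H \<and> acts_freely H \<and> type_I \<phi> A B \<subseteq> H)"
  shows "\<exists>r. coprime r (int n) \<and>
       \<not> [r = 1] (mod (int n)) \<and> \<not> [r = - 1] (mod (int n)) \<and>
       (let k1 = gcd (1 + r) (int n); k2 = gcd (1 - r) (int n) in
          (k1 = 1 \<and> k2 = 1) \<or>
          ((k1 > 1 \<or> k2 > 1) \<and>
           (\<forall>k\<in>{k1, k2}. k > 1 \<longrightarrow>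
              (\<forall>m::nat. m \<ge> 2 \<and> B = cyc m \<longrightarrow> gcd (int m) k = 1) \<and>
              (\<forall>m::nat. m \<ge> 2 \<and> B = bin_dihedral m \<longrightarrow> gcd (2 * int m) k = 1) \<and>
              (B = bin_tetrahedral \<or> B = bin_octahedral \<longrightarrow> \<not> 2 dvd k \<and> \<not> 3 dvd k) \<and>
              (B = bin_icosahedral \<longrightarrow> \<not> 2 dvd k \<and> \<not> 3 dvd k \<and> \<not> 5 dvd k)))) \<and>
       type_I \<phi> A B = type_I (power_aut r) (cyc n) B"
proof -
  have n: "n > 0" using assms(1) by simp
  have "n \<ge> 2" using assms(1) by simp
  then have "ADE A" using assms(2) unfolding ADE_def by blast
  note free = ADE_subgroup(1) [OF \<open>ADE A\<close>] ADE_subgroup(1) [OF assms(3)] assms(4,5)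
  have zA: "range (zeta n) \<subseteq> A" by (simp add: assms(2) cyc_zeta)
  obtain r where co: "coprime r (int n)" and z: "\<And>x. \<phi> (zeta n x) = zeta n (r * x)"
    using automorphism_cyc [OF n] assms(2,4) by blast
  have pm: "\<not> ([r = 1] (mod int n) \<or> [r = - 1] (mod int n))"
  proof
    assume "[r = 1] (mod int n) \<or> [r = - 1] (mod int n)"
    then have "qre (zeta n (r * x)) = qre (zeta n x)" for x by (rule qre_zeta_pm [OF n])
    then have "qre (\<phi> x) = qre x" if "x \<in> A" for x
      using that unfolding assms(2) cyc_zeta by (auto simp: z)
    then show False using not_re_preserving [OF \<open>ADE A\<close> assms(3-6)] by blast
  qed
  let ?k1 = "gcd (1 + r) (int n)" and ?k2 = "gcd (1 - r) (int n)"
  let ?no_common = "\<lambda>k. (\<forall>m::nat. m \<ge> 2 \<and> B = cyc m \<longrightarrow> gcd (int m) k = 1) \<and>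
      (\<forall>m::nat. m \<ge> 2 \<and> B = bin_dihedral m \<longrightarrow> gcd (2 * int m) k = 1) \<and>
      (B = bin_tetrahedral \<or> B = bin_octahedral \<longrightarrow> \<not> 2 dvd k \<and> \<not> 3 dvd k) \<and>
      (B = bin_icosahedral \<longrightarrow> \<not> 2 dvd k \<and> \<not> 3 dvd k \<and> \<not> 5 dvd k)"
  have no_common: "?no_common k"
    if k: "k \<in> {?k1, ?k2}" for k
  proof -
    note coprime = free_cyclic_factor_coprime [OF free zA n z k]
    note root = free_no_fixed_root [OF free zA n z k]
    have T: "\<not> 2 dvd k \<and> \<not> 3 dvd k" if "bin_tetrahedral \<subseteq> B"
    proof -
      have "minus_one \<in> B" using minus_one_in_bin_tetrahedral that by blast
      moreover have "Quat (-1/2) (1/2) (1/2) (1/2) \<in> B"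
        using bin_tetrahedral_halfI that by auto
      ultimately show ?thesis
        using root [of 2 minus_one] root [of 3 "Quat (-1/2) (1/2) (1/2) (1/2)"]
        by (auto simp: zeta_2 zeta_3_5)
    qed
    have I: "\<not> 5 dvd k" if "B = bin_icosahedral"
    proof -
      have "ico_q ^ 2 \<in> B"
        unfolding that bin_icosahedral_iff using one_in_bin_tetrahedral
        by (intro exI [of _ 2] exI [of _ 1]) simp
      moreover have "qre (ico_q ^ 2) = qre (zeta 5 1)" by (simp add: ico_q_powers zeta_3_5)
      ultimately show ?thesis using root [of 5 "ico_q ^ 2"] by auto
    qed
    have "gcd (int m) k = 1" if "m \<ge> 2" "B = cyc m" for m
      using coprime [of m] that by (simp add: cyc_zeta)
    moreover have "gcd (2 * int m) k = 1" if "m \<ge> 2" "B = bin_dihedral m" for m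
      using coprime [of "2 * m"] that by (simp add: bin_dihedral_zeta)
    moreover have "bin_tetrahedral \<subseteq> bin_octahedral" by (simp add: bin_octahedral_def)
    ultimately show ?thesis using T I bin_tetrahedral_subset_icosahedral by blast
  qed
  have "?k1 > 0" "?k2 > 0" using n by simp_all
  then have "(?k1 = 1 \<and> ?k2 = 1) \<or> (?k1 > 1 \<or> ?k2 > 1)" by linarith
  then have cases: "let k1 = ?k1; k2 = ?k2 in (k1 = 1 \<and> k2 = 1) \<or>
      ((k1 > 1 \<or> k2 > 1) \<and> (\<forall>k\<in>{k1, k2}. k > 1 \<longrightarrow> ?no_common k))"
    unfolding Let_def
  proof (rule disj_forward)
    assume "?k1 > 1 \<or> ?k2 > 1"
    then show "(?k1 > 1 \<or> ?k2 > 1) \<and> (\<forall>k\<in>{?k1, ?k2}. k > 1 \<longrightarrow> ?no_common k)"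
      by (intro conjI [OF _ ballI] impI no_common)
  qed
  have pm': "\<not> [r = 1] (mod int n)" "\<not> [r = - 1] (mod int n)" using pm by simp_all
  have "type_I \<phi> A B = type_I (power_aut r) (cyc n) B"
    unfolding assms(2) by (rule type_I_cong) (auto simp: cyc_zeta z power_aut_zeta)
  then show ?thesis by (intro exI [of _ r] conjI co pm' cases)
qed

theorem theorem4p3:
  fixes A B :: "quat set" and \<phi> :: "quat \<Rightarrow> quat"
  assumes "ADE A" and "ADE B"
    and "\<phi> \<in> automorphisms A"
    and "acts_freely (type_I \<phi> A B)"
    and "\<not> (\<exists>H. splittable H \<and> acts_freely H \<and> type_I \<phi> A B \<subseteq> H)"
  shows "\<exists>g\<in>carrier GG.
    (\<exists>n::nat. n \<ge> 2 \<and> \<not> 3 dvd n \<and> \<phi> \<in> automorphisms bin_icosahedral \<and>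
       conjugate_subset g (type_I \<phi> A B) = type_I \<phi> bin_icosahedral (cyc n))
    \<or>
    (\<exists>(n::nat) (m::nat) (a::int) (b::int).
       n > 2 \<and> m \<ge> 2 \<and> coprime a (2 * int n) \<and>
       \<not> [a = 1] (mod (2 * int n)) \<and> \<not> [a = - 1] (mod (2 * int n)) \<and>
       \<not> 4 dvd m \<and>
       (\<forall>k\<in>{gcd (1 + a) (2 * int n), gcd (1 - a) (2 * int n)}. k > 1 \<longrightarrow> gcd k (int m) = 1) \<and>
       conjugate_subset g (type_I \<phi> A B) = type_I (tau n a b) (bin_dihedral n) (cyc m))
    \<or>
    (\<exists>(n::nat) (r::int).
       n \<ge> 2 \<and> coprime r (int n) \<and>
       \<not> [r = 1] (mod (int n)) \<and> \<not> [r = - 1] (mod (int n)) \<and>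
       (let k1 = gcd (1 + r) (int n); k2 = gcd (1 - r) (int n) in
          (k1 = 1 \<and> k2 = 1) \<or>
          ((k1 > 1 \<or> k2 > 1) \<and>
           (\<forall>k\<in>{k1, k2}. k > 1 \<longrightarrow>
              (\<forall>m::nat. m \<ge> 2 \<and> B = cyc m \<longrightarrow> gcd (int m) k = 1) \<and>
              (\<forall>m::nat. m \<ge> 2 \<and> B = bin_dihedral m \<longrightarrow> gcd (2 * int m) k = 1) \<and>
              (B = bin_tetrahedral \<or> B = bin_octahedral \<longrightarrow> \<not> 2 dvd k \<and> \<not> 3 dvd k) \<and>
              (B = bin_icosahedral \<longrightarrow> \<not> 2 dvd k \<and> \<not> 3 dvd k \<and> \<not> 5 dvd k)))) \<and>
       conjugate_subset g (type_I \<phi> A B) = type_I (power_aut r) (cyc n) B)"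
proof -
  have carrier: "type_I \<phi> A B \<subseteq> carrier GG"
    using type_I_carrier [OF _ _ equalityD1 [OF automorphism_image [OF assms(3)]]]
      subgroup.subset [OF ADE_subgroup(1)] assms(1,2) by blast
  note id = conjugate_subset_one [OF carrier]
  consider (cyc) n where "n \<ge> 2" "A = cyc n" | (dih) n where "n > 2" "A = bin_dihedral n"
    | (ico) "A = bin_icosahedral"
  proof -
    have small: False if "A = bin_dihedral 2 \<or> A = bin_tetrahedral \<or> A = bin_octahedral"
      using small_orders_in_splittable [OF assms(1-4) that] assms(5) by (rule notE [rotated])
    from assms(1) show thesis
      unfolding ADE_def
    proof (elim disjE exE conjE)
      fix n :: nat assume n: "n \<ge> 2" "A = bin_dihedral n"
      then have "n \<noteq> 2" using small by blast
      then have "n > 2" using n(1) by simp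
      then show thesis using n(2) by (rule dih)
    next
      fix n :: nat assume "n \<ge> 2" "A = cyc n"
      then show thesis by (rule cyc)
    next
      assume "A = bin_icosahedral"
      then show thesis by (rule ico)
    qed (use small in blast)+
  qed
  then show ?thesis
  proof cases
    case cyc
    show ?thesis
      using type_I_cyclic [OF cyc assms(2-5)]
      by (intro bexI [of _ "(1, 1, 1)"], unfold id, elim exE)
        (rule disjI2, rule disjI2, rule exI [of _ n], rule exI, rule conjI, rule cyc(1), assumption, simp)
  next
    case dih
    show ?thesis
      using type_I_dihedral [OF dih assms(2-5)]
      by (intro bexI [of _ "(1, 1, 1)"], unfold id, elim exE)
        (rule disjI2, rule disjI1, rule exI [of _ n], rule exI, rule exI, rule exI, rule conjI,
          rule dih(1), assumption, simp)
  next
    case ico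
    then obtain m where m: "m \<ge> 2" "\<not> 3 dvd m" "B = cyc m"
      using type_I_icosahedral assms(2-4) by blast
    have "type_I \<phi> A B = type_I \<phi> bin_icosahedral (cyc m)" by (simp only: ico m(3))
    moreover have "\<phi> \<in> automorphisms bin_icosahedral" using assms(3) ico by simp
    ultimately show ?thesis
      using m(1,2)
      by (intro bexI [of _ "(1, 1, 1)"], unfold id) (rule disjI1, rule exI [of _ m], intro conjI, assumption+, simp)
  qed
qed

end
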